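(* Let $(X,\|\cdot\|)$ be a uniformly convex and uniformly smooth reflexive real Banach space of dimension $\geq 3$, with dual $X^*$ and duality pairing $\langle\cdot,\cdot\rangle$. Then the following assertions are equivalent: (i) The metric projection onto every nonempty closed linear subspace of $X$ is linear; (ii) The metric projection onto the intersection of any pair of closed hyperplanes of $X$ is linear; (iii) $J^{-1}:X^*\to X$ maps two-dimensional linear subspaces of $X^*$ onto two-dimensional linear subspaces of $X$, i.e. for every two-dimensional linear subspace $\mathcal D\subseteq X^*$, the set $J^{-1}(\mathcal D)$ is a two-dimensional linear subspace of $X$; (iv) The polar of the intersection of any pair of closed halfspaces of $X$ is convex; (v) Each nonempty closed convex cone in $X$ has a convex polar; (vi) $X$ is an inner product space (its norm is generated by an inner product).
   Context: For a nonempty closed convex set $C\subseteq X$, the metric projection $P_C:X\to C$ is $P_Cx=\operatorname{argmin}\{\|x-c\|: c\in C\}$ (well defined and single valued in this setting). A closed hyperplane is a set $\{x\in X:\langle a,x\rangle=0\}$ with $a\in X^*$, $\|a\|^*=1$; the associated closed halfspaces are $\{x:\langle a,x\rangle\ge 0\}$ and $\{x:\langle a,x\rangle\le 0\}$ (these pass through the origin, so intersections of two of them are closed convex cones). A set $K\subseteq X$ is a cone if $\lambda x\in K$ for all $x\in K$, $\lambda\ge 0$, and a convex cone if moreover $x+y\in K$ for $x,y\in K$. For a nonempty closed convex cone $K$, its polar is $K^\circ=\{x\in X: P_Kx=0\}$. The normalized duality map $J:X\to X^*$ is defined by $\langle Jx,x\rangle=\|Jx\|^*\|x\|=\|x\|^2=(\|Jx\|^*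 )^2$; in this setting it is a single-valued homeomorphism with inverse $J^{-1}:X^*\to X$. *)

theory Defs
  imports "HOL-Analysis.Analysis"
begin

text \<open>The space X is a type 'a of class banach; its dual X* is the type
  'a \<Rightarrow>L real of bounded linear functionals (operator norm); the duality
  pairing is function application.\<close>

definition uniformly_convex :: "'a::real_normed_vector itself \<Rightarrow> bool" where
  "uniformly_convex _ \<longleftrightarrow>
     (\<forall>\<epsilon>>0. \<exists>\<delta>>0. \<forall>x y::'a. norm x \<le> 1 \<and> norm y \<le> 1 \<and> norm (x - y) \<ge> \<epsilon>
        \<longrightarrow> norm ((1/2) *\<^sub>R (x + y)) \<le> 1 - \<delta>)"

text \<open>Uniform smoothness: the modulus of smoothness
  rho(t) = sup { (||x+ty|| + ||x-ty||)/2 - 1 : ||x|| = ||y|| = 1 } satisfies rho(t)/t \<rightarrow> 0 as t \<rightarrow> 0+.\<close>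
definition uniformly_smooth :: "'a::real_normed_vector itself \<Rightarrow> bool" where
  "uniformly_smooth _ \<longleftrightarrow>
     (\<forall>\<epsilon>>0. \<exists>\<delta>>0. \<forall>t. 0 < t \<and> t < \<delta> \<longrightarrow>
        (\<forall>x y::'a. norm x = 1 \<and> norm y = 1 \<longrightarrow>
           (norm (x + t *\<^sub>R y) + norm (x - t *\<^sub>R y)) / 2 - 1 \<le> \<epsilon> * t))"

definition reflexive_space :: "'a::real_normed_vector itself \<Rightarrow> bool" where
  "reflexive_space _ \<longleftrightarrow>
     (\<forall>\<phi> :: ('a \<Rightarrow>\<^sub>L real) \<Rightarrow>\<^sub>L real. \<exists>x::'a. \<forall>f. blinfun_apply \<phi> f = blinfun_apply f x)"

definition metric_proj :: "'a::real_normed_vector set \<Rightarrow> 'a \<Rightarrow> 'a" where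
  "metric_proj C x = (THE c. c \<in> C \<and> (\<forall>d\<in>C. norm (x - c) \<le> norm (x - d)))"

definition closed_hyperplane :: "'a::real_normed_vector set \<Rightarrow> bool" where
  "closed_hyperplane H \<longleftrightarrow> (\<exists>a :: 'a \<Rightarrow>\<^sub>L real. norm a = 1 \<and> H = {x. blinfun_apply a x = 0})"

definition closed_halfspace :: "'a::real_normed_vector set \<Rightarrow> bool" where
  "closed_halfspace H \<longleftrightarrow> (\<exists>a :: 'a \<Rightarrow>\<^sub>L real. norm a = 1 \<and>
      (H = {x. blinfun_apply a x \<ge> 0} \<or> H = {x. blinfun_apply a x \<le> 0}))"

definition polar :: "'a::real_normed_vector set \<Rightarrow> 'a set" where
  "polar K = {x. metric_proj K x = 0}"

definition duality_map :: "'a::real_normed_vector \<Rightarrow> ('a \<Rightarrow>\<^sub>L real)" where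
  "duality_map x = (THE f. blinfun_apply f x = (norm x)\<^sup>2 \<and> norm f = norm x)"

definition inner_product_space :: "'a::real_normed_vector itself \<Rightarrow> bool" where
  "inner_product_space _ \<longleftrightarrow>
     (\<exists>B :: 'a \<Rightarrow> 'a \<Rightarrow> real. (\<forall>x y. B x y = B y x) \<and> (\<forall>y. linear (\<lambda>x. B x y))
        \<and> (\<forall>x. norm x = sqrt (B x x)))"

end

theory Submission
  imports Defs
begin

text \<open>By uniform smoothness, \<open>F x = \<parallel>x\<parallel>\<^sup>2 / 2\<close> is differentiable with gradient the duality map
  \<open>J\<close>, which is weakly continuous; by uniform convexity, nearest points exist and \<open>J\<close> is bijective.
  Since \<open>P\<^sub>C x = c\<close> is the variational inequality \<open>\<langle>J (x - c), d - c\<rangle> \<le> 0\<close> on \<open>C\<close>, all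
  assertions hold when \<open>J\<close> is linear, and each of (ii), (iii), (iv) forces
  \<open>J (x + y) \<in> span {J x, J y}\<close>. Conversely, this condition makes \<open>J\<close> a collineation, so in
  dimension at least three it is, on each plane, proportional to a linear map \<open>w\<close> (fundamental
  theorem of projective geometry; continuity excludes wild additive functions). Integrating the
  resulting equation \<open>dF \<parallel> w\<close> along a logarithmic spiral shows that the spiral closes up, hence
  that \<open>F\<close> is a quadratic form on the plane and that \<open>\<langle>J x, y\<rangle>\<close> is symmetric. Being linear in
  \<open>y\<close>, it is the required inner product.\<close>

section \<open>Convexity of the squared norm, additive functions, pairs of functionals\<close>

lemma norm_sq_midpoint_le:
  fixes x y :: "'a::real_normed_vector"
  shows "(norm ((1/2) *\<^sub>R (x + y)))\<^sup>2 \<le> ((norm x)\<^sup>2 + (norm y)\<^sup>2) / 2"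
proof -
  have "norm ((1/2) *\<^sub>R (x + y)) \<le> (norm x + norm y) / 2"
    using norm_triangle_ineq[of x y] by simp
  then have "(norm ((1/2) *\<^sub>R (x + y)))\<^sup>2 \<le> ((norm x + norm y) / 2)\<^sup>2"
    by (rule power_mono) simp
  also have "\<dots> \<le> ((norm x)\<^sup>2 + (norm y)\<^sup>2) / 2"
    using zero_le_power2[of "norm x - norm y"] by (simp add: power2_eq_square field_simps)
  finally show ?thesis .
qed

text \<open>The deviation \<open>h\<close> from linearity is additive and vanishes at the integers,
  so it has period 1, and continuity on the unit interval bounds it everywhere. Since
  \<open>h (of_nat n * t) = of_nat n * h t\<close>, boundedness forces \<open>h = 0\<close>.\<close>

lemma additive_continuous_imp_linear:
  fixes g :: "real \<Rightarrow> real"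
  assumes add: "\<And>s t. g (s + t) = g s + g t" and cont: "continuous_on UNIV g"
  shows "g t = t * g 1"
proof -
  define h where "h t = g t - t * g 1" for t
  have h_add: "h (s + t) = h s + h t" for s t
    by (simp add: h_def add algebra_simps)
  have h1: "h 1 = 0" by (simp add: h_def)
  have h0: "h 0 = 0" using h_add[of 0 0] by simp
  have h_nat_mult: "h (of_nat n * t) = of_nat n * h t" for n t
    by (induction n) (simp_all add: h0 h_add algebra_simps)
  have h_neg: "h (- t) = - h t" for t
    using h_add[of t "- t"] h0 by simp
  have h_int: "h (of_int k) = 0" for k
  proof (cases k)
    case (nonneg n) then show ?thesis using h_nat_mult[of n 1] h1 by simp
  next
    case (neg n)
    then show ?thesis using h_nat_mult[of "Suc n" 1] h1 h_neg[of "of_nat (Suc n)"] by simp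
  qed
  have "continuous_on {0..1} h"
    unfolding h_def by (intro continuous_intros continuous_on_subset[OF cont]) auto
  then have "bounded (h ` {0..1})"
    by (intro compact_imp_bounded compact_continuous_image) auto
  then obtain M where M: "\<And>t. t \<in> {0..1} \<Longrightarrow> \<bar>h t\<bar> \<le> M"
    unfolding bounded_iff by (metis imageI real_norm_def)
  have bd: "\<bar>h t\<bar> \<le> M" for t
  proof -
    have "h t = h (frac t) + h (of_int \<lfloor>t\<rfloor>)"
      using h_add[of "frac t" "of_int \<lfloor>t\<rfloor>"] by (simp add: frac_def)
    then have "h t = h (frac t)" by (simp add: h_int)
    moreover have "frac t \<in> {0..1}" using frac_lt_1[of t] by (simp add: less_imp_le)
    ultimately show ?thesis using M by simp
  qed
  have "h t = 0"
  proof (rule ccontr)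
    assume "h t \<noteq> 0"
    then obtain n :: nat where "M < of_nat n * \<bar>h t\<bar>"
      using reals_Archimedean3[of "\<bar>h t\<bar>"] by auto
    moreover have "of_nat n * \<bar>h t\<bar> = \<bar>h (of_nat n * t)\<bar>"
      by (simp add: h_nat_mult abs_mult)
    ultimately show False using bd[of "of_nat n * t"] by simp
  qed
  then show ?thesis by (simp add: h_def)
qed

text \<open>Evaluation at \<open>u\<close> and \<open>v\<close> reads off the coefficients of a
  combination of \<open>a\<close> and \<open>b\<close>, which is how coefficients of values of
  \<open>J\<close> are extracted later. Each vector arises by correcting some \<open>x\<close> into
  the kernel of \<open>b\<close>; independence ensures that \<open>a\<close> does not vanish on the
  result.\<close>

lemma functionals_dual_pair:
  fixes a b :: "'a::real_normed_vector \<Rightarrow>\<^sub>L real"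
  assumes ind: "\<And>\<alpha> \<beta>. \<alpha> *\<^sub>R a + \<beta> *\<^sub>R b = 0 \<Longrightarrow> \<alpha> = 0 \<and> \<beta> = 0"
  obtains u v where "a u = 1" "b u = 0" "a v = 0" "b v = 1"
proof -
  have ker: "\<exists>x. a x = 1 \<and> b x = 0"
    if ind: "\<And>\<alpha> \<beta>. \<alpha> *\<^sub>R a + \<beta> *\<^sub>R b = 0 \<Longrightarrow> \<alpha> = 0 \<and> \<beta> = 0"
    for a b :: "'a \<Rightarrow>\<^sub>L real"
  proof -
    have "b \<noteq> 0" using ind[of 0 1] by auto
    then obtain x0 where x0: "b x0 \<noteq> 0"
      by (metis blinfun_eqI blinfun.zero_left)
    have "a - (a x0 / b x0) *\<^sub>R b \<noteq> 0" using ind[of 1 "- (a x0 / b x0)"] by auto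
    then obtain x where x: "a x - a x0 / b x0 * b x \<noteq> 0"
      by (metis blinfun_eqI blinfun.zero_left blinfun.diff_left blinfun.scaleR_left real_scaleR_def)
    define y where "y = x - (b x / b x0) *\<^sub>R x0"
    have "b y = 0" "a y \<noteq> 0"
      using x x0 by (simp_all add: y_def blinfun.diff_right blinfun.scaleR_right mult.commute)
    then have "a ((1 / a y) *\<^sub>R y) = 1 \<and> b ((1 / a y) *\<^sub>R y) = 0"
      by (simp add: blinfun.scaleR_right)
    then show ?thesis by blast
  qed
  obtain u where "a u = 1" "b u = 0" using ker[OF ind] by blast
  moreover obtain v where "b v = 1" "a v = 0"
    using ker[of b a] ind by (metis add.commute)
  ultimately show ?thesis using that by blast
qed

lemma functional_vanishing_on_two_kernels:
  fixes a b c :: "'a::real_normed_vector \<Rightarrow>\<^sub>L real"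
  assumes uv: "a u = 1" "b u = 0" "a v = 0" "b v = 1"
    and van: "\<And>x. a x = 0 \<Longrightarrow> b x = 0 \<Longrightarrow> c x = 0"
  shows "c = c u *\<^sub>R a + c v *\<^sub>R b"
proof (rule blinfun_eqI)
  fix x
  have "c (x - a x *\<^sub>R u - b x *\<^sub>R v) = 0"
    by (rule van) (simp_all add: blinfun.diff_right blinfun.scaleR_right uv)
  then show "c x = (c u *\<^sub>R a + c v *\<^sub>R b) x"
    by (simp add: blinfun.diff_right blinfun.scaleR_right blinfun.add_left blinfun.scaleR_left
        mult.commute)
qed

lemma subspace_kernel: "subspace {z. blinfun_apply a z = 0}"
  by (auto simp: subspace_def blinfun.add_right blinfun.scaleR_right)

lemma closed_kernel: "closed {z. blinfun_apply a z = (0::real)}"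
  by (intro closed_Collect_eq continuous_intros)

text \<open>Phrased for a pair rather than for the set \<open>{x, y}\<close>, so that equal vectors
  count as dependent.\<close>

definition lin_indep2 :: "'a::real_vector \<Rightarrow> 'a \<Rightarrow> bool" where
  "lin_indep2 x y \<longleftrightarrow> (\<forall>\<alpha> \<beta>. \<alpha> *\<^sub>R x + \<beta> *\<^sub>R y = 0 \<longrightarrow> \<alpha> = 0 \<and> \<beta> = 0)"

definition lin_indep3 :: "'a::real_vector \<Rightarrow> 'a \<Rightarrow> 'a \<Rightarrow> bool" where
  "lin_indep3 x y z \<longleftrightarrow>
    (\<forall>\<alpha> \<beta> \<gamma>. \<alpha> *\<^sub>R x + \<beta> *\<^sub>R y + \<gamma> *\<^sub>R z = 0 \<longrightarrow> \<alpha> = 0 \<and> \<beta> = 0 \<and> \<gamma> = 0)"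

lemma lin_indep3_imp_lin_indep2:
  assumes "lin_indep3 x y z"
  shows "lin_indep2 x y" "lin_indep2 x z"
  using assms unfolding lin_indep3_def lin_indep2_def
  by (metis add.right_neutral scaleR_zero_left)+

lemma lin_dep2_cases:
  assumes "\<not> lin_indep2 x y"
  obtains k where "x = k *\<^sub>R y \<or> y = k *\<^sub>R x"
proof -
  obtain \<alpha> \<beta> where ab: "\<alpha> *\<^sub>R x + \<beta> *\<^sub>R y = 0" "\<alpha> \<noteq> 0 \<or> \<beta> \<noteq> 0"
    using assms unfolding lin_indep2_def by blast
  have solve: "v = (- c / d) *\<^sub>R u" if "c *\<^sub>R u + d *\<^sub>R v = 0" "d \<noteq> 0" for c d and u v :: 'a
  proof -
    have "d *\<^sub>R v = d *\<^sub>R ((- c / d) *\<^sub>R u)" using that by (simp add: add_eq_0_iff)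
    then show ?thesis using that(2) by (simp only: scaleR_cancel_left) simp
  qed
  show ?thesis using ab solve[of \<alpha> x \<beta> y] solve[of \<beta> y \<alpha> x] that by (metis add.commute)
qed

section \<open>The duality map as the gradient of half the squared norm\<close>

locale uniform_banach =
  fixes X :: "'a::banach itself"
  assumes uniform_convexity: "uniformly_convex X" and uniform_smoothness: "uniformly_smooth X"
begin

abbreviation J :: "'a \<Rightarrow> 'a \<Rightarrow>\<^sub>L real" where "J \<equiv> duality_map"

definition F :: "'a \<Rightarrow> real" where "F x = (norm x)\<^sup>2 / 2"

lemma F_scaleR: "F (c *\<^sub>R x) = c\<^sup>2 * F x"
  by (simp add: F_def power_mult_distrib)

text \<open>The form in which uniform smoothness is used. By homogeneity the bound on the unit
  sphere transfers to \<open>x\<close> and \<open>v\<close>, with \<open>t = s * m / n\<close>;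
  passing from the norm to its square adds only a term of order \<open>s * s\<close>.\<close>

lemma F_second_difference:
  fixes x v :: 'a
  assumes "\<epsilon> > 0"
  obtains \<delta> where "\<delta> > 0" "\<And>s. 0 < s \<Longrightarrow> s < \<delta> \<Longrightarrow> F (x + s *\<^sub>R v) + F (x - s *\<^sub>R v) - 2 * F x \<le> \<epsilon> * s"
proof (cases "x = 0 \<or> v = 0")
  case True
  then show ?thesis
  proof
    assume "x = 0"
    show ?thesis
    proof (rule that[of "\<epsilon> / ((norm v)\<^sup>2 + 1)"])
      show "\<epsilon> / ((norm v)\<^sup>2 + 1) > 0" using assms by (simp add: add_nonneg_pos)
      fix s :: real assume s: "0 < s" "s < \<epsilon> / ((norm v)\<^sup>2 + 1)"
      have "(norm v)\<^sup>2 + 1 > 0" by (simp add: add_nonneg_pos)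
      then have "s * ((norm v)\<^sup>2 + 1) \<le> \<epsilon>" using s by (simp add: field_simps)
      then have "s * (norm v)\<^sup>2 \<le> \<epsilon>" using s by (simp add: algebra_simps)
      then have "s * (norm v)\<^sup>2 * s \<le> \<epsilon> * s" using s by (intro mult_right_mono) auto
      then show "F (x + s *\<^sub>R v) + F (x - s *\<^sub>R v) - 2 * F x \<le> \<epsilon> * s"
        using \<open>x = 0\<close> by (simp add: F_def power2_eq_square algebra_simps)
    qed
  next
    assume "v = 0"
    then show ?thesis using assms by (intro that[of 1]) auto
  qed
next
  case False
  define n where "n = norm x"
  define m where "m = norm v"
  have n: "n > 0" and m: "m > 0" using False by (auto simp: n_def m_def)
  have "\<epsilon> / (4 * n * m) > 0" using n m assms by simp
  then obtain d where d: "d > 0" "\<And>t y z. 0 < t \<Longrightarrow> t < d \<Longrightarrow> norm (y::'a) = 1 \<Longrightarrow> norm z = 1 \<Longrightarrow>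
      (norm (y + t *\<^sub>R z) + norm (y - t *\<^sub>R z)) / 2 - 1 \<le> \<epsilon> / (4 * n * m) * t"
    using uniform_smoothness unfolding uniformly_smooth_def by meson
  show ?thesis
  \<comment> \<open>The first bound gives \<open>t < d\<close>, so that the linear part
    \<open>n * (p + q)\<close> takes at most half of the error; the second keeps the quadratic part
    within the other half.\<close>
  proof (rule that[of "min (d * n / m) (\<epsilon> / (2 * m\<^sup>2))"])
    show "min (d * n / m) (\<epsilon> / (2 * m\<^sup>2)) > 0" using d n m assms by simp
    fix s :: real assume s: "0 < s" and s2: "s < min (d * n / m) (\<epsilon> / (2 * m\<^sup>2))"
    define t where "t = s * m / n"
    have t: "0 < t" "t < d" using s s2 n m by (simp_all add: t_def field_simps)
    define y z where "y = (1 / n) *\<^sub>R x" and "z = (1 / m) *\<^sub>R v"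
    have yz: "norm y = 1" "norm z = 1" using n m by (auto simp: y_def z_def n_def m_def)
    have eqs: "x + s *\<^sub>R v = n *\<^sub>R (y + t *\<^sub>R z)" "x - s *\<^sub>R v = n *\<^sub>R (y - t *\<^sub>R z)"
      using n m by (simp_all add: y_def z_def t_def algebra_simps)
    define p q where "p = norm (x + s *\<^sub>R v) - n" and "q = norm (x - s *\<^sub>R v) - n"
    have "(norm (y + t *\<^sub>R z) + norm (y - t *\<^sub>R z)) / 2 - 1 \<le> \<epsilon> / (4 * n * m) * t"
      using d(2)[OF t yz] .
    then have "n * ((norm (y + t *\<^sub>R z) + norm (y - t *\<^sub>R z)) / 2 - 1) \<le> n * (\<epsilon> / (4 * n * m) * t)"
      using n by (intro mult_left_mono) auto
    moreover have "n * ((norm (y + t *\<^sub>R z) + norm (y - t *\<^sub>R z)) / 2 - 1) = (p + q) / 2"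
      using n unfolding p_def q_def eqs norm_scaleR by (simp add: field_simps)
    moreover have "n * (\<epsilon> / (4 * n * m) * t) = \<epsilon> * s / (4 * n)"
      using n m by (simp add: t_def field_simps)
    ultimately have "(p + q) / 2 \<le> \<epsilon> * s / (4 * n)" by simp
    then have pq: "n * (p + q) \<le> \<epsilon> * s / 2" using n by (simp add: field_simps)
    have "\<bar>p\<bar> \<le> s * m"
      using s norm_triangle_ineq3[of "x + s *\<^sub>R v" x] by (simp add: p_def n_def m_def)
    then have p2: "p\<^sup>2 \<le> (s * m)\<^sup>2" using s m by (metis abs_le_square_iff abs_of_pos mult_pos_pos)
    have "\<bar>q\<bar> \<le> s * m"
      using s norm_triangle_ineq3[of "x - s *\<^sub>R v" x] by (simp add: q_def n_def m_def)
    then have q2: "q\<^sup>2 \<le> (s * m)\<^sup>2" using s m by (metis abs_le_square_iff abs_of_pos mult_pos_pos)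
    have "s * (2 * m\<^sup>2) \<le> \<epsilon>" using s2 m by (simp add: field_simps)
    then have "s * (s * (2 * m\<^sup>2)) \<le> s * \<epsilon>" using s by (intro mult_left_mono) auto
    then have sm: "(s * m)\<^sup>2 \<le> \<epsilon> * s / 2" by (simp add: power2_eq_square algebra_simps)
    have "F (x + s *\<^sub>R v) + F (x - s *\<^sub>R v) - 2 * F x = ((p + n)\<^sup>2 + (q + n)\<^sup>2 - 2 * n\<^sup>2) / 2"
      by (simp add: F_def p_def q_def n_def field_simps)
    also have "\<dots> = n * (p + q) + (p\<^sup>2 + q\<^sup>2) / 2"
      by (simp add: power2_eq_square field_simps)
    also have "\<dots> \<le> \<epsilon> * s / 2 + \<epsilon> * s / 2"
    proof (rule add_mono[OF pq order_trans[OF _ sm]])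
      show "(p\<^sup>2 + q\<^sup>2) / 2 \<le> (s * m)\<^sup>2" using add_mono[OF p2 q2] by simp
    qed
    also have "\<dots> = \<epsilon> * s" by simp
    finally show "F (x + s *\<^sub>R v) + F (x - s *\<^sub>R v) - 2 * F x \<le> \<epsilon> * s" .
  qed
qed

lemma support_functional_subgradient:
  fixes x y :: 'a
  assumes "blinfun_apply f x = (norm x)\<^sup>2" "norm f = norm x"
  shows "f (y - x) \<le> F y - F x"
proof -
  have "f y \<le> norm x * norm y" using norm_blinfun[of f y] assms(2) by simp
  also have "\<dots> \<le> F x + F y"
    using zero_le_power2[of "norm x - norm y"] by (simp add: F_def power2_eq_square field_simps)
  finally show ?thesis using assms(1) by (simp add: F_def blinfun.diff_right)
qed

text \<open>The functional is the one-sided derivative \<open>p\<close> of \<open>F\<close> at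
  \<open>x\<close>, an infimum of slopes. Convexity makes \<open>p\<close> subadditive, the small
  second difference makes it odd, and with positive homogeneity this gives linearity.\<close>

lemma support_functional_exists:
  fixes x :: 'a
  shows
  "\<exists>f. blinfun_apply f x = (norm x)\<^sup>2 \<and> norm f = norm x"
proof -
  define q where "q v s = (F (x + s *\<^sub>R v) - F x) / s" for v s
  define p where "p v = (INF s\<in>{0<..}. q v s)" for v
  have low: "- norm x * norm v \<le> q v s" if "s > 0" for v s
  proof -
    have "norm x - s * norm v \<le> norm (x + s *\<^sub>R v)"
      using norm_diff_ineq[of x "s *\<^sub>R v"] that by simp
    then have "norm x * (norm x - s * norm v) \<le> norm x * norm (x + s *\<^sub>R v)"
      by (intro mult_left_mono) auto
    also have "\<dots> \<le> F (x + s *\<^sub>R v) + F x"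
      using zero_le_power2[of "norm x - norm (x + s *\<^sub>R v)"]
      by (simp add: F_def power2_eq_square field_simps)
    finally have "- (s * (norm x * norm v)) \<le> F (x + s *\<^sub>R v) - F x"
      by (simp add: F_def power2_eq_square algebra_simps)
    then show ?thesis using that by (simp add: q_def field_simps)
  qed
  have bdd: "bdd_below (q v ` {0<..})" for v
    using low by (intro bdd_belowI[of _ "- norm x * norm v"]) auto
  have p_le: "p v \<le> q v s" if "s > 0" for v s
    unfolding p_def using that bdd by (intro cINF_lower) auto
  have p_ge: "l \<le> p v" if "\<And>s. s > 0 \<Longrightarrow> l \<le> q v s" for l v
    unfolding p_def using that by (intro cINF_greatest) auto
  have p_approx: "\<exists>s>0. q v s < p v + \<epsilon>" if "\<epsilon> > 0" for v \<epsilon>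
    using p_ge[of "p v + \<epsilon>" v] that by (meson add_le_same_cancel1 linorder_not_le)
  \<comment> \<open>By convexity the slopes grow with the step, so in \<open>p_sub\<close> a common
    smaller step \<open>r\<close> serves both directions.\<close>
  have q_mono: "q v s \<le> q v t" if "0 < s" "s \<le> t" for v s t
  proof -
    define k where "k = s / t"
    have k: "0 < k" "k \<le> 1" using that by (auto simp: k_def)
    have "x + s *\<^sub>R v = (1 - k) *\<^sub>R x + k *\<^sub>R (x + t *\<^sub>R v)"
      using that by (simp add: k_def algebra_simps)
    then have "norm (x + s *\<^sub>R v) \<le> (1 - k) * norm x + k * norm (x + t *\<^sub>R v)"
      using k norm_triangle_ineq[of "(1 - k) *\<^sub>R x" "k *\<^sub>R (x + t *\<^sub>R v)"] by simp
    then have "(norm (x + s *\<^sub>R v))\<^sup>2 \<le> ((1 - k) * norm x + k * norm (x + t *\<^sub>R v))\<^sup>2"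
      by (rule power_mono) simp
    also have "\<dots> \<le> (1 - k) * (norm x)\<^sup>2 + k * (norm (x + t *\<^sub>R v))\<^sup>2"
    proof -
      have "0 \<le> k * (1 - k) * (norm x - norm (x + t *\<^sub>R v))\<^sup>2" using k by simp
      then show ?thesis by (simp add: power2_eq_square algebra_simps)
    qed
    finally have "F (x + s *\<^sub>R v) - F x \<le> k * (F (x + t *\<^sub>R v) - F x)"
      by (simp add: F_def field_simps)
    then show ?thesis using that by (simp add: q_def k_def field_simps)
  qed
  have p_sub: "p (v + w) \<le> p v + p w" for v w
  proof (rule field_le_epsilon)
    fix e :: real assume "e > 0"
    obtain s t where st: "s > 0" "q v s < p v + e / 2" "t > 0" "q w t < p w + e / 2"
      using p_approx[of "e / 2"] \<open>e > 0\<close> by (metis half_gt_zero)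
    define r where "r = min s t"
    have r: "r > 0" "q v r < p v + e / 2" "q w r < p w + e / 2"
      using st q_mono[of r s v] q_mono[of r t w] by (auto simp: r_def)
    have eq: "x + (r / 2) *\<^sub>R (v + w) = (1/2) *\<^sub>R ((x + r *\<^sub>R v) + (x + r *\<^sub>R w))"
      by (simp add: algebra_simps flip: scaleR_add_left)
    have "F (x + (r / 2) *\<^sub>R (v + w)) \<le> (F (x + r *\<^sub>R v) + F (x + r *\<^sub>R w)) / 2"
      unfolding F_def eq using norm_sq_midpoint_le[of "x + r *\<^sub>R v" "x + r *\<^sub>R w"]
      by (simp add: field_simps)
    then have "(F (x + (r / 2) *\<^sub>R (v + w)) - F x) / (r / 2)
        \<le> ((F (x + r *\<^sub>R v) + F (x + r *\<^sub>R w)) / 2 - F x) / (r / 2)"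
      using r(1) by (intro divide_right_mono diff_right_mono) auto
    also have "\<dots> = q v r + q w r"
      using r(1) by (simp add: q_def field_simps)
    finally have "q (v + w) (r / 2) \<le> q v r + q w r"
      by (simp add: q_def)
    moreover have "p (v + w) \<le> q (v + w) (r / 2)" using p_le r(1) by simp
    ultimately show "p (v + w) \<le> p v + p w + e" using r by simp
  qed
  have p0: "p 0 = 0"
    using p_le[of 1 0] p_ge[of 0 0] by (simp add: q_def)
  have p_neg: "p (- v) = - p v" for v
  proof -
    have "p v + p (- v) \<le> 0"
    proof (rule field_le_epsilon)
      fix e :: real assume "e > 0"
      then obtain d where d: "d > 0"
        "\<And>s. 0 < s \<Longrightarrow> s < d \<Longrightarrow> F (x + s *\<^sub>R v) + F (x - s *\<^sub>R v) - 2 * F x \<le> e * s"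
        using F_second_difference by blast
      have "q v (d/2) + q (- v) (d/2) = (F (x + (d/2) *\<^sub>R v) + F (x - (d/2) *\<^sub>R v) - 2 * F x) / (d / 2)"
        using d(1) by (simp add: q_def field_simps)
      also have "\<dots> \<le> e" using d(2)[of "d/2"] d(1) by (simp add: field_simps)
      finally show "p v + p (- v) \<le> 0 + e"
        using p_le[of "d/2" v] p_le[of "d/2" "- v"] d(1) by simp
    qed
    moreover have "0 \<le> p v + p (- v)" using p_sub[of v "- v"] p0 by simp
    ultimately show ?thesis by simp
  qed
  have p_add: "p (v + w) = p v + p w" for v w
  proof (rule antisym[OF p_sub])
    have "p v \<le> p (v + w) + p (- w)" using p_sub[of "v + w" "- w"] by simp
    then show "p v + p w \<le> p (v + w)" by (simp add: p_neg)
  qed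
  have p_pos: "p (c *\<^sub>R v) \<le> c * p v" if "c > 0" for c v
  proof -
    have "p (c *\<^sub>R v) / c \<le> p v"
    proof (rule p_ge)
      fix s :: real assume "s > 0"
      have "p (c *\<^sub>R v) \<le> q (c *\<^sub>R v) (s / c)" using p_le \<open>s > 0\<close> that by simp
      also have "\<dots> = c * q v s" using \<open>s > 0\<close> that by (simp add: q_def field_simps)
      finally show "p (c *\<^sub>R v) / c \<le> q v s" using that by (simp add: field_simps)
    qed
    then show ?thesis using that by (simp add: field_simps)
  qed
  have p_pos_eq: "p (c *\<^sub>R v) = c * p v" if "c > 0" for c v
  proof (rule antisym[OF p_pos[OF that]])
    show "c * p v \<le> p (c *\<^sub>R v)" using p_pos[of "1 / c" "c *\<^sub>R v"] that by (simp add: field_simps)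
  qed
  have p_scale: "p (c *\<^sub>R v) = c * p v" for c v
  proof (cases "c > 0 \<or> c = 0")
    case True then show ?thesis using p_pos_eq p0 by auto
  next
    case False
    then show ?thesis using p_pos_eq[of "- c" v] p_neg[of "c *\<^sub>R v"] by simp
  qed
  have p_bound: "p v \<le> norm x * norm v" for v
    using p_neg[of v] p_ge[of "- norm x * norm (- v)" "- v"] low[of _ "- v"] by simp
  have p_abs: "\<bar>p v\<bar> \<le> norm v * norm x" for v
    using p_bound[of v] p_bound[of "- v"] p_neg[of v] by (simp add: abs_le_iff mult.commute)
  have bl: "bounded_linear p"
    by (rule bounded_linear_intro[where K = "norm x"]) (auto simp: p_add p_scale p_abs)
  have px: "p x = (norm x)\<^sup>2"
  proof (rule antisym)
    show "p x \<le> (norm x)\<^sup>2" using p_bound[of x] by (simp add: power2_eq_square)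
    show "(norm x)\<^sup>2 \<le> p x"
    proof (rule p_ge)
      fix s :: real assume "s > 0"
      have "x + s *\<^sub>R x = (1 + s) *\<^sub>R x" by (simp add: algebra_simps)
      then have "F (x + s *\<^sub>R x) = (1 + s)\<^sup>2 * F x" by (simp only: F_scaleR)
      then have "q x s = ((1 + s)\<^sup>2 - 1) * F x / s" by (simp add: q_def algebra_simps)
      also have "\<dots> = (norm x)\<^sup>2 + s * F x" using \<open>s > 0\<close>
        by (simp add: F_def power2_eq_square field_simps)
      finally show "(norm x)\<^sup>2 \<le> q x s" using \<open>s > 0\<close> by (simp add: F_def)
    qed
  qed
  have app: "blinfun_apply (Blinfun p) = p" using bl by (rule bounded_linear_Blinfun_apply)
  have "norm (Blinfun p) \<le> norm x"
    by (rule norm_blinfun_bound) (auto simp: app p_abs mult.commute)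
  moreover have "norm x \<le> norm (Blinfun p)"
  proof (cases "x = 0")
    case False
    have "norm x * norm x \<le> norm (Blinfun p) * norm x"
      using norm_blinfun[of "Blinfun p" x] px app by (simp add: power2_eq_square)
    then show ?thesis using False by simp
  qed simp
  ultimately have "norm (Blinfun p) = norm x" by simp
  then show ?thesis using px app by (intro exI[of _ "Blinfun p"]) simp
qed

text \<open>Support functionals are subgradients of \<open>F\<close>. A forward step tested with
  \<open>f\<close> and a backward step tested with \<open>g\<close> bound \<open>f v - g v\<close>
  by a second difference quotient, which is arbitrarily small.\<close>

lemma support_functional_unique:
  fixes x :: 'a
  assumes f: "blinfun_apply f x = (norm x)\<^sup>2" "norm f = norm x"
    and g: "blinfun_apply g x = (norm x)\<^sup>2" "norm g = norm x"
  shows "f = g"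
proof -
  have le: "f v \<le> g v" if f: "blinfun_apply f x = (norm x)\<^sup>2" "norm f = norm x"
    and g: "blinfun_apply g x = (norm x)\<^sup>2" "norm g = norm x" for f g v
  proof (rule field_le_epsilon)
    fix e :: real assume "e > 0"
    then obtain d where d: "d > 0"
      "\<And>s. 0 < s \<Longrightarrow> s < d \<Longrightarrow> F (x + s *\<^sub>R v) + F (x - s *\<^sub>R v) - 2 * F x \<le> e * s"
      using F_second_difference by blast
    have "(d/2) * f v \<le> F (x + (d/2) *\<^sub>R v) - F x"
      using support_functional_subgradient[OF f, of "x + (d/2) *\<^sub>R v"]
      by (simp add: blinfun.scaleR_right)
    moreover have "- (d/2) * g v \<le> F (x - (d/2) *\<^sub>R v) - F x"
      using support_functional_subgradient[OF g, of "x - (d/2) *\<^sub>R v"]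
      by (simp add: blinfun.scaleR_right blinfun.minus_right)
    ultimately have "(d/2) * (f v - g v) \<le> (d/2) * e"
      using d(2)[of "d/2"] d(1) by (simp add: algebra_simps)
    then show "f v \<le> g v + e" using d(1) by simp
  qed
  show ?thesis using le[OF f g] le[OF g f] by (intro blinfun_eqI antisym)
qed

lemma J_self: "J x x = (norm x)\<^sup>2" and norm_J: "norm (J x) = norm x"
proof -
  obtain f where f: "blinfun_apply f x = (norm x)\<^sup>2 \<and> norm f = norm x"
    using support_functional_exists by blast
  then have "blinfun_apply (J x) x = (norm x)\<^sup>2 \<and> norm (J x) = norm x"
    unfolding duality_map_def by (rule theI) (use f support_functional_unique in blast)
  then show "J x x = (norm x)\<^sup>2" "norm (J x) = norm x" by auto
qed

lemma J_eqI: "blinfun_apply f x = (norm x)\<^sup>2 \<Longrightarrow> norm f = norm x \<Longrightarrow> J x = f"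
  using support_functional_unique J_self norm_J by blast

lemma J_subgradient: "J x (y - x) \<le> F y - F x"
  using support_functional_subgradient J_self norm_J by blast

lemma J_eq_0_iff: "J x = 0 \<longleftrightarrow> x = 0"
  by (metis norm_J norm_eq_zero)

lemma J_scaleR: "J (c *\<^sub>R x) = c *\<^sub>R J x"
  by (rule J_eqI) (simp_all add: blinfun.scaleR_left blinfun.scaleR_right J_self norm_J
      power_mult_distrib power2_eq_square[of c] flip: mult.assoc)

lemma J_bound: "\<bar>J x v\<bar> \<le> norm x * norm v"
  using norm_blinfun[of "J x" v] by (simp add: norm_J)

text \<open>\<open>J_subgradient\<close> puts \<open>J x v\<close> below every slope; with this
  converse estimate \<open>J x v\<close> is the infimum of the slopes.\<close>

lemma J_upper_slope:
  fixes x v :: 'a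
  assumes "\<epsilon> > 0"
  obtains s where "s > 0" "(F (x + s *\<^sub>R v) - F x) / s < J x v + \<epsilon>"
proof -
  have "\<epsilon> / 2 > 0" using assms by simp
  then obtain d where d: "d > 0"
    "\<And>s. 0 < s \<Longrightarrow> s < d \<Longrightarrow> F (x + s *\<^sub>R v) + F (x - s *\<^sub>R v) - 2 * F x \<le> \<epsilon> / 2 * s"
    using F_second_difference by metis
  define s where "s = d / 2"
  have s: "0 < s" "s < d" using d(1) by (auto simp: s_def)
  have "- s * J x v \<le> F (x - s *\<^sub>R v) - F x"
    using J_subgradient[of x "x - s *\<^sub>R v"] by (simp add: blinfun.scaleR_right blinfun.minus_right)
  then have "F (x + s *\<^sub>R v) - F x \<le> s * (J x v + \<epsilon> / 2)"
    using d(2)[OF s] by (simp add: algebra_simps)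
  then have "(F (x + s *\<^sub>R v) - F x) / s \<le> J x v + \<epsilon> / 2" using s by (simp add: field_simps)
  then show ?thesis using that[of s] s assms by simp
qed

section \<open>Continuity of the duality map and derivatives along curves\<close>

text \<open>For a fixed step the slope is continuous in the base point, so the infimum
  \<open>J x v\<close> is upper semicontinuous in \<open>x\<close>. Replacing \<open>v\<close> by
  \<open>- v\<close> gives lower semicontinuity.\<close>

lemma tendsto_J_fixed:
  fixes x v :: 'a
  assumes "(g \<longlongrightarrow> x) G"
  shows "((\<lambda>n. J (g n) v) \<longlongrightarrow> J x v) G"
proof -
  have up: "\<forall>\<^sub>F n in G. J (g n) v < r" if less: "J x v < r" for r v
  proof -
    obtain s where s: "s > 0" "(F (x + s *\<^sub>R v) - F x) / s < J x v + (r - J x v)"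
      using J_upper_slope[of "r - J x v" x v] less by (metis diff_gt_0_iff_gt)
    have "((\<lambda>n. (F (g n + s *\<^sub>R v) - F (g n)) / s) \<longlongrightarrow> (F (x + s *\<^sub>R v) - F x) / s) G"
      unfolding F_def using s by (intro tendsto_intros assms) auto
    then have "\<forall>\<^sub>F n in G. (F (g n + s *\<^sub>R v) - F (g n)) / s < r"
      using s by (intro order_tendstoD) auto
    then show ?thesis
    proof eventually_elim
      case (elim n)
      have "s * J (g n) v \<le> F (g n + s *\<^sub>R v) - F (g n)"
        using J_subgradient[of "g n" "g n + s *\<^sub>R v"] by (simp add: blinfun.scaleR_right)
      then have "J (g n) v \<le> (F (g n + s *\<^sub>R v) - F (g n)) / s" using s by (simp add: field_simps)
      then show ?case using elim by simp
    qed
  qed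
  show ?thesis
  proof (rule order_tendstoI)
    fix r assume "r < J x v"
    then have "\<forall>\<^sub>F n in G. J (g n) (- v) < - r" using up[of "- v" "- r"] by (simp add: blinfun.minus_right)
    then show "\<forall>\<^sub>F n in G. r < J (g n) v" by (simp add: blinfun.minus_right)
  qed (use up in auto)
qed

lemma tendsto_J:
  fixes x v :: 'a
  assumes g: "(g \<longlongrightarrow> x) G" and w: "(w \<longlongrightarrow> v) G"
  shows "((\<lambda>n. J (g n) (w n)) \<longlongrightarrow> J x v) G"
proof -
  have "((\<lambda>n. norm (g n) * norm (w n - v)) \<longlongrightarrow> norm x * norm (v - v)) G"
    by (intro tendsto_intros g w)
  then have lim0: "((\<lambda>n. norm (g n) * norm (w n - v)) \<longlongrightarrow> 0) G" by simp
  have "((\<lambda>n. J (g n) (w n - v)) \<longlongrightarrow> 0) G"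
    by (rule Lim_null_comparison[OF _ lim0]) (simp add: J_bound)
  then have "((\<lambda>n. J (g n) (w n - v) + J (g n) v) \<longlongrightarrow> 0 + J x v) G"
    by (intro tendsto_add tendsto_J_fixed g)
  then show ?thesis by (simp add: blinfun.diff_right)
qed

text \<open>The subgradient inequalities at the two ends trap the difference quotient between the
  values of \<open>J (p t)\<close> and \<open>J (p (t + h))\<close> at \<open>r h\<close>, and by
  \<open>tendsto_J\<close> both tend to \<open>J (p t) p'\<close>.\<close>

lemma F_path_has_derivative:
  fixes p :: "real \<Rightarrow> 'a"
  assumes "(p has_vector_derivative p') (at t)"
  shows "((\<lambda>t. F (p t)) has_real_derivative J (p t) p') (at t)"
proof -
  define r where "r h = (1 / h) *\<^sub>R (p (t + h) - p t)" for h
  have "((\<lambda>h. norm (p (t + h) - p t - h *\<^sub>R p') / norm h) \<longlongrightarrow> 0) (at 0)"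
    using assms unfolding has_vector_derivative_def has_derivative_at by simp
  moreover have "\<forall>\<^sub>F h in at 0. norm (p (t + h) - p t - h *\<^sub>R p') / norm h = norm (r h - p')"
    unfolding eventually_at_filter
  proof (intro always_eventually allI impI)
    fix h :: real assume "h \<noteq> 0"
    then have "r h - p' = (1 / h) *\<^sub>R (p (t + h) - p t - h *\<^sub>R p')"
      by (simp add: r_def algebra_simps)
    then show "norm (p (t + h) - p t - h *\<^sub>R p') / norm h = norm (r h - p')" by simp
  qed
  ultimately have "((\<lambda>h. norm (r h - p')) \<longlongrightarrow> 0) (at 0)"
    by (rule Lim_transform_eventually)
  then have r: "(r \<longlongrightarrow> p') (at 0)"
    using Lim_null tendsto_norm_zero_iff by blast
  have pc: "((\<lambda>h. p (t + h)) \<longlongrightarrow> p t) (at 0)"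
    using has_vector_derivative_continuous[OF assms] unfolding continuous_at LIM_offset_zero_iff
    by (simp add: LIM_offset_zero)
  have lim1: "((\<lambda>h. J (p t) (r h)) \<longlongrightarrow> J (p t) p') (at 0)"
    by (intro tendsto_J r tendsto_const)
  have lim2: "((\<lambda>h. J (p (t + h)) (r h)) \<longlongrightarrow> J (p t) p') (at 0)"
    by (intro tendsto_J r pc)
  have bound: "\<bar>(F (p (t + h)) - F (p t)) / h - J (p t) (r h)\<bar> \<le> \<bar>J (p (t + h)) (r h) - J (p t) (r h)\<bar>"
    if "h \<noteq> 0" for h
  proof -
    define D where "D = p (t + h) - p t"
    have D: "D = h *\<^sub>R r h" using that by (simp add: D_def r_def)
    have 1: "h * J (p t) (r h) \<le> F (p (t + h)) - F (p t)"
      using J_subgradient[of "p t" "p (t + h)"] by (simp add: D blinfun.scaleR_right flip: D_def)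
    have "J (p (t + h)) (- D) \<le> F (p t) - F (p (t + h))"
      using J_subgradient[of "p (t + h)" "p t"] by (simp add: D_def)
    then have 2: "F (p (t + h)) - F (p t) \<le> h * J (p (t + h)) (r h)"
      by (simp add: D blinfun.scaleR_right blinfun.minus_right)
    have "\<bar>F (p (t + h)) - F (p t) - h * J (p t) (r h)\<bar> \<le> \<bar>h * (J (p (t + h)) (r h) - J (p t) (r h))\<bar>"
      using 1 2 by (simp add: algebra_simps)
    then have "\<bar>F (p (t + h)) - F (p t) - h * J (p t) (r h)\<bar> / \<bar>h\<bar> \<le> \<bar>J (p (t + h)) (r h) - J (p t) (r h)\<bar>"
      using that by (simp only: abs_mult) (simp add: pos_divide_le_eq mult.commute)
    moreover have "(F (p (t + h)) - F (p t)) / h - J (p t) (r h) = (F (p (t + h)) - F (p t) - h * J (p t) (r h)) / h"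
      using that by (simp add: field_simps)
    ultimately show ?thesis by (simp add: abs_divide)
  qed
  have "((\<lambda>h. \<bar>J (p (t + h)) (r h) - J (p t) (r h)\<bar>) \<longlongrightarrow> \<bar>J (p t) p' - J (p t) p'\<bar>) (at 0)"
    by (intro tendsto_intros lim1 lim2)
  then have "((\<lambda>h. \<bar>J (p (t + h)) (r h) - J (p t) (r h)\<bar>) \<longlongrightarrow> 0) (at 0)" by simp
  then have "((\<lambda>h. (F (p (t + h)) - F (p t)) / h - J (p t) (r h)) \<longlongrightarrow> 0) (at 0)"
    by (rule Lim_null_comparison[rotated]) (simp add: eventually_at_filter bound)
  from tendsto_add[OF this lim1] show ?thesis
    by (simp add: DERIV_def)
qed

section \<open>Nearest points and the variational inequality for projections\<close>

text \<open>If two near-minimizers were far apart, then after scaling them into the unit ball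
  uniform convexity would put their midpoint, which lies in \<open>C\<close>, closer to
  \<open>x\<close> than the lower bound \<open>d\<close> allows.\<close>

lemma near_minimizers_close:
  fixes x :: 'a
  assumes C: "convex C" and d: "\<And>c. c \<in> C \<Longrightarrow> d \<le> norm (x - c)" "d \<ge> 0" and e: "e > 0"
  shows "\<exists>\<eta>>0. \<forall>c\<in>C. \<forall>c'\<in>C. norm (x - c) < d + \<eta> \<and> norm (x - c') < d + \<eta> \<longrightarrow> norm (c - c') < e"
proof (cases "d = 0")
  case True
  have "norm (c - c') < e" if "norm (x - c) < e / 2" "norm (x - c') < e / 2" for c c'
    using that norm_triangle_ineq4[of "x - c'" "x - c"] by simp
  then show ?thesis using True e by (intro exI[of _ "e / 2"]) auto
next
  case False
  then have dpos: "d > 0" using d by simp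
  have "e / (2 * d) > 0" using e dpos by simp
  then obtain \<delta> where \<delta>: "\<delta> > 0" "\<And>y z. norm (y::'a) \<le> 1 \<Longrightarrow> norm z \<le> 1 \<Longrightarrow>
      norm (y - z) \<ge> e / (2 * d) \<Longrightarrow> norm ((1/2) *\<^sub>R (y + z)) \<le> 1 - \<delta>"
    using uniform_convexity unfolding uniformly_convex_def by meson
  \<comment> \<open>From \<open>\<eta> \<le> d\<close> follows \<open>N \<le> 2 * d\<close>, so the
    scaled points stay \<open>e / (2 * d)\<close> apart;
    \<open>\<eta> \<le> d * \<delta> / 2\<close> makes \<open>N * (1 - \<delta>)\<close> smaller
    than \<open>d\<close>.\<close>
  define \<eta> where "\<eta> = min d (d * \<delta> / 2)"
  define N where "N = d + \<eta>"
  have eta: "\<eta> > 0" "\<eta> \<le> d" using dpos \<delta>(1) by (auto simp: \<eta>_def)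
  then have N: "N > 0" "N \<le> 2 * d" "d \<le> N" using dpos by (auto simp: N_def)
  have "norm (c - c') < e" if c: "c \<in> C" "c' \<in> C" "norm (x - c) < N" "norm (x - c') < N" for c c'
  proof (rule ccontr)
    assume "\<not> norm (c - c') < e"
    then have ge: "e \<le> norm (c' - c)" by (simp add: norm_minus_commute)
    define y z where "y = (1 / N) *\<^sub>R (x - c)" and "z = (1 / N) *\<^sub>R (x - c')"
    have yz: "norm y \<le> 1" "norm z \<le> 1" using c N by (simp_all add: y_def z_def)
    have "y - z = (1 / N) *\<^sub>R (c' - c)" by (simp add: y_def z_def algebra_simps)
    then have "norm (y - z) = norm (c' - c) / N" using N by simp
    moreover have "e / (2 * d) \<le> e / N" using e N dpos by (intro divide_left_mono) auto
    moreover have "e / N \<le> norm (c' - c) / N" using ge N by (intro divide_right_mono) auto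
    ultimately have "norm ((1/2) *\<^sub>R (y + z)) \<le> 1 - \<delta>" using \<delta>(2)[OF yz] by simp
    then have "N * norm ((1/2) *\<^sub>R (y + z)) \<le> N * (1 - \<delta>)" using N by (intro mult_left_mono) auto
    moreover have "x - ((1/2) *\<^sub>R c + (1/2) *\<^sub>R c') = N *\<^sub>R ((1/2) *\<^sub>R (y + z))"
    proof -
      have "N *\<^sub>R ((1/2) *\<^sub>R (y + z)) = (1/2) *\<^sub>R (x - c) + (1/2) *\<^sub>R (x - c')"
        using N by (simp add: y_def z_def scaleR_add_right)
      also have "\<dots> = x - ((1/2) *\<^sub>R c + (1/2) *\<^sub>R c')"
        by (simp add: scaleR_diff_right flip: scaleR_add_left)
      finally show ?thesis by simp
    qed
    then have "norm (x - ((1/2) *\<^sub>R c + (1/2) *\<^sub>R c')) = N * norm ((1/2) *\<^sub>R (y + z))"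
      using N by simp
    moreover have "(1/2) *\<^sub>R c + (1/2) *\<^sub>R c' \<in> C" using C c by (intro convexD) auto
    then have "d \<le> norm (x - ((1/2) *\<^sub>R c + (1/2) *\<^sub>R c'))" by (rule d)
    ultimately have "d \<le> N - N * \<delta>" by (simp add: algebra_simps)
    moreover have "d * \<delta> \<le> N * \<delta>" using N \<delta> by (intro mult_right_mono) auto
    moreover have "N \<le> d + d * \<delta> / 2" by (simp add: N_def \<eta>_def)
    moreover have "d * \<delta> > 0" using dpos \<delta> by simp
    ultimately show False by argo
  qed
  then show ?thesis using eta by (auto simp: N_def)
qed

text \<open>\<open>near_minimizers_close\<close> makes a minimizing sequence Cauchy, and
  completeness supplies the limit. Applied to two minimizers it makes their distance smaller than
  every positive number.\<close>

lemma nearest_point_exists: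
  fixes C :: "'a set"
  assumes C: "convex C" "closed C" "C \<noteq> {}"
  shows "\<exists>!c. c \<in> C \<and> (\<forall>d\<in>C. norm (x - c) \<le> norm (x - d))"
proof -
  define d where "d = (INF c\<in>C. norm (x - c))"
  have bdd: "bdd_below ((\<lambda>c. norm (x - c)) ` C)" by (intro bdd_belowI[of _ 0]) auto
  have d_le: "d \<le> norm (x - c)" if "c \<in> C" for c
    unfolding d_def using bdd that by (rule cINF_lower)
  have d0: "d \<ge> 0" unfolding d_def using C by (intro cINF_greatest) auto
  have "\<exists>c\<in>C. norm (x - c) < d + 1 / real (Suc n)" for n
  proof -
    have "d < d + 1 / real (Suc n)" by simp
    then show ?thesis unfolding d_def using cINF_less_iff[OF C(3) bdd] by blast
  qed
  then obtain c where c: "\<And>n. c n \<in> C" "\<And>n. norm (x - c n) < d + 1 / real (Suc n)" by metis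
  have "Cauchy c"
  proof (rule CauchyI)
    fix e :: real assume "e > 0"
    then obtain \<eta> where \<eta>: "\<eta> > 0" "\<And>a b. a \<in> C \<Longrightarrow> b \<in> C \<Longrightarrow> norm (x - a) < d + \<eta> \<Longrightarrow>
        norm (x - b) < d + \<eta> \<Longrightarrow> norm (a - b) < e"
      using near_minimizers_close[OF C(1) d_le d0] by metis
    obtain M where M: "1 / real (Suc M) < \<eta>" using nat_approx_posE[OF \<eta>(1)] by blast
    have small: "norm (x - c n) < d + \<eta>" if "n \<ge> M" for n
    proof -
      have "1 / real (Suc n) \<le> 1 / real (Suc M)" using that by (intro divide_left_mono) auto
      then show ?thesis using c(2)[of n] M by simp
    qed
    show "\<exists>M. \<forall>m\<ge>M. \<forall>n\<ge>M. norm (c m - c n) < e"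
      using \<eta>(2)[OF c(1) c(1) small small] by blast
  qed
  then obtain l where l: "c \<longlonglongrightarrow> l" using Cauchy_convergent_iff convergent_def by blast
  have lC: "l \<in> C" using closed_sequentially[OF C(2)] c(1) l by blast
  have "norm (x - l) \<le> d"
  proof (rule LIMSEQ_le)
    show "(\<lambda>n. norm (x - c n)) \<longlonglongrightarrow> norm (x - l)" by (intro tendsto_intros l)
    have "(\<lambda>n. d + 1 / real (Suc n)) \<longlonglongrightarrow> d + 0"
      by (intro tendsto_add tendsto_const LIMSEQ_Suc lim_1_over_n)
    then show "(\<lambda>n. d + 1 / real (Suc n)) \<longlonglongrightarrow> d" by simp
  qed (use c(2) less_imp_le in blast)
  then have min: "\<forall>a\<in>C. norm (x - l) \<le> norm (x - a)" using d_le by force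
  show ?thesis
  proof (rule ex1I[of _ l])
    fix b assume b: "b \<in> C \<and> (\<forall>d\<in>C. norm (x - b) \<le> norm (x - d))"
    have bd: "norm (x - b) \<le> d" using b lC \<open>norm (x - l) \<le> d\<close> by force
    have "norm (b - l) < e" if e: "e > 0" for e
    proof -
      obtain \<eta> where \<eta>: "\<eta> > 0" "\<And>a b. a \<in> C \<Longrightarrow> b \<in> C \<Longrightarrow> norm (x - a) < d + \<eta> \<Longrightarrow>
          norm (x - b) < d + \<eta> \<Longrightarrow> norm (a - b) < e"
        using near_minimizers_close[OF C(1) d_le d0 e] by metis
      show ?thesis using b lC bd \<open>norm (x - l) \<le> d\<close> \<eta>(1) by (intro \<eta>(2)) auto
    qed
    then have "\<not> 0 < norm (b - l)" by blast
    then show "b = l" by simp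
  qed (use lC min in simp)
qed

text \<open>Forward: a small move from \<open>c\<close> towards \<open>d\<close> does not decrease
  \<open>F\<close>, so the second difference and the subgradient inequality for the opposite move
  give the sign of \<open>J (x - c) (c - d)\<close>. Backward: the inequality yields
  \<open>(norm (x - c))\<^sup>2 \<le> J (x - c) (x - d)\<close>, and \<open>J_bound\<close> allows
  one factor to be cancelled.\<close>

lemma nearest_point_iff_J:
  fixes C :: "'a set"
  assumes C: "convex C" and c: "c \<in> C"
  shows "(\<forall>d\<in>C. norm (x - c) \<le> norm (x - d)) \<longleftrightarrow> (\<forall>d\<in>C. J (x - c) (d - c) \<le> 0)"
proof safe
  fix d assume min: "\<forall>d\<in>C. norm (x - c) \<le> norm (x - d)" and d: "d \<in> C"
  define u where "u = x - c"
  define v where "v = c - d"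
  have "- J u v \<le> 0"
  proof (rule field_le_epsilon)
    fix e :: real assume "e > 0"
    then obtain \<delta> where \<delta>: "\<delta> > 0"
      "\<And>s. 0 < s \<Longrightarrow> s < \<delta> \<Longrightarrow> F (u + s *\<^sub>R v) + F (u - s *\<^sub>R v) - 2 * F u \<le> e * s"
      using F_second_difference by blast
    define s where "s = min (\<delta> / 2) 1"
    have s: "0 < s" "s < \<delta>" "s \<le> 1" using \<delta>(1) by (auto simp: s_def)
    have "(1 - s) *\<^sub>R c + s *\<^sub>R d \<in> C" using C c d s by (intro convexD) auto
    then have "norm u \<le> norm (x - ((1 - s) *\<^sub>R c + s *\<^sub>R d))" using min by (simp add: u_def)
    also have "x - ((1 - s) *\<^sub>R c + s *\<^sub>R d) = u + s *\<^sub>R v" by (simp add: u_def v_def algebra_simps)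
    finally have "(norm u)\<^sup>2 \<le> (norm (u + s *\<^sub>R v))\<^sup>2" by (rule power_mono) simp
    then have "F u \<le> F (u + s *\<^sub>R v)" by (simp add: F_def)
    moreover have "- s * J u v \<le> F (u - s *\<^sub>R v) - F u"
      using J_subgradient[of u "u - s *\<^sub>R v"] by (simp add: blinfun.scaleR_right blinfun.minus_right)
    ultimately have "s * (- J u v) \<le> s * e" using \<delta>(2)[OF s(1,2)] by (simp add: algebra_simps)
    then have "- J u v \<le> e" using s(1) mult_le_cancel_left_pos by blast
    then show "- J u v \<le> 0 + e" by simp
  qed
  then show "J (x - c) (d - c) \<le> 0" by (simp add: u_def v_def blinfun.diff_right)
next
  fix d assume vi: "\<forall>d\<in>C. J (x - c) (d - c) \<le> 0" and d: "d \<in> C"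
  have "x - d = (x - c) - (d - c)" by simp
  then have "J (x - c) (x - d) = (norm (x - c))\<^sup>2 - J (x - c) (d - c)"
    by (simp only: blinfun.diff_right[of _ "x - c" "d - c"] J_self)
  moreover have "J (x - c) (d - c) \<le> 0" using vi d by blast
  moreover have "J (x - c) (x - d) \<le> norm (x - c) * norm (x - d)"
    using J_bound[of "x - c" "x - d"] by simp
  ultimately have "norm (x - c) * norm (x - c) \<le> norm (x - c) * norm (x - d)"
    by (simp add: power2_eq_square)
  then show "norm (x - c) \<le> norm (x - d)"
    by (cases "x = c") auto
qed

lemma metric_proj_eq_iff:
  fixes C :: "'a set"
  assumes C: "convex C" "closed C" "C \<noteq> {}"
  shows "metric_proj C x = c \<longleftrightarrow> c \<in> C \<and> (\<forall>d\<in>C. J (x - c) (d - c) \<le> 0)"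
proof -
  note ex = nearest_point_exists[OF C, of x]
  have "metric_proj C x = c \<longleftrightarrow> c \<in> C \<and> (\<forall>d\<in>C. norm (x - c) \<le> norm (x - d))"
    unfolding metric_proj_def using the1_equality[OF ex] theI'[OF ex] by blast
  then show ?thesis using nearest_point_iff_J[OF C(1)] by blast
qed

text \<open>In a subspace both \<open>c + d\<close> and \<open>c - d\<close> may be tested, which
  turns the inequality into an equation.\<close>

lemma metric_proj_subspace_eq_iff:
  fixes M :: "'a set"
  assumes M: "subspace M" "closed M"
  shows "metric_proj M x = c \<longleftrightarrow> c \<in> M \<and> (\<forall>d\<in>M. J (x - c) d = 0)"
proof -
  have "(\<forall>d\<in>M. J (x - c) (d - c) \<le> 0) \<longleftrightarrow> (\<forall>d\<in>M. J (x - c) d = 0)" if c: "c \<in> M"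
  proof safe
    fix d assume vi: "\<forall>d\<in>M. J (x - c) (d - c) \<le> 0" and d: "d \<in> M"
    have "J (x - c) ((c + d) - c) \<le> 0" "J (x - c) ((c - d) - c) \<le> 0"
      using vi M(1) c d by (auto simp only: subspace_add subspace_diff)
    then show "J (x - c) d = 0" by (simp add: blinfun.minus_right)
  next
    fix d assume "\<forall>d\<in>M. J (x - c) d = 0" "d \<in> M"
    then show "J (x - c) (d - c) \<le> 0" using M(1) c by (simp add: subspace_diff)
  qed
  then show ?thesis
    using metric_proj_eq_iff[OF subspace_imp_convex[OF M(1)] M(2)] subspace_0[OF M(1)] by blast
qed

lemma polar_eq:
  fixes K :: "'a set"
  assumes "convex_cone K" "closed K"
  shows "polar K = {x. \<forall>d\<in>K. J x d \<le> 0}"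
proof -
  have "0 \<in> K" "convex K" using assms(1) by (auto simp: convex_cone_def conic_contains_0)
  then show ?thesis unfolding polar_def
    using metric_proj_eq_iff[of K _ 0] assms(2) by auto
qed

section \<open>Bijectivity of the duality map\<close>

text \<open>If \<open>J x = J y\<close>, both points are nearest to the origin in the set
  \<open>C\<close> on which this functional takes the value \<open>(norm x)\<^sup>2\<close>; nearest
  points are unique.\<close>

lemma inj_J: "inj J"
proof (rule injI)
  fix x y :: 'a assume eq: "J x = J y"
  then have n: "norm x = norm y" by (metis norm_J)
  define C where "C = {z. J x z = (norm x)\<^sup>2}"
  have C: "convex C" "closed C"
  proof -
    show "closed C" unfolding C_def by (intro closed_Collect_eq continuous_intros)
    show "convex C"
      by (auto simp: C_def convex_def blinfun.add_right blinfun.scaleR_right simp flip: distrib_right)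
  qed
  have xy: "x \<in> C" "y \<in> C" using eq n J_self[of x] J_self[of y] by (auto simp: C_def)
  have Jneg: "J (- z) = - J z" for z using J_scaleR[of "-1" z] by simp
  have "metric_proj C 0 = z" if "z \<in> C" "J z = J x" for z
    using that metric_proj_eq_iff[OF C, of 0 z]
    by (auto simp: C_def Jneg blinfun.minus_left blinfun.diff_right)
  then show "x = y" using xy eq by metis
qed

text \<open>Project a point with \<open>f x1 = 1\<close> onto the kernel of \<open>f\<close>. The
  functional \<open>J z\<close> of the residual \<open>z\<close> vanishes on that kernel, hence is a
  multiple of \<open>f\<close>, and homogeneity removes the factor.\<close>

lemma surj_J: "surj J"
proof -
  have "\<exists>x. J x = f" for f :: "'a \<Rightarrow>\<^sub>L real"
  proof (cases "f = 0")
    case True then show ?thesis using J_eq_0_iff by blast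
  next
    case False
    then obtain x0 where "f x0 \<noteq> 0" by (metis blinfun_eqI blinfun.zero_left)
    define x1 where "x1 = (1 / f x0) *\<^sub>R x0"
    have x1: "f x1 = 1" using \<open>f x0 \<noteq> 0\<close> by (simp add: x1_def blinfun.scaleR_right)
    define M where "M = {x. f x = 0}"
    have sM: "subspace M" and cM: "closed M"
      unfolding M_def by (rule subspace_kernel closed_kernel)+
    define c where "c = metric_proj M x1"
    have c: "c \<in> M" "\<And>d. d \<in> M \<Longrightarrow> J (x1 - c) d = 0"
      using metric_proj_subspace_eq_iff[OF sM cM] c_def by blast+
    define z where "z = x1 - c"
    have fz: "f z = 1" using c(1) x1 by (simp add: z_def M_def blinfun.diff_right)
    have "J z = (norm z)\<^sup>2 *\<^sub>R f"
    proof (rule blinfun_eqI)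
      fix y
      have "y - f y *\<^sub>R z \<in> M" by (simp add: M_def blinfun.diff_right blinfun.scaleR_right fz)
      then have "J z (y - f y *\<^sub>R z) = 0" using c(2) z_def by blast
      then show "J z y = ((norm z)\<^sup>2 *\<^sub>R f) y"
        by (simp add: blinfun.diff_right blinfun.scaleR_right blinfun.scaleR_left J_self mult.commute)
    qed
    moreover have "z \<noteq> 0" using fz by auto
    ultimately have "J ((1 / (norm z)\<^sup>2) *\<^sub>R z) = f" by (simp add: J_scaleR)
    then show ?thesis by blast
  qed
  then show ?thesis by (metis surjI)
qed

lemma J_eq_iff: "J x = J y \<longleftrightarrow> x = y"
  using inj_J by (auto dest: injD)

lemma J_lin_indep2: "lin_indep2 x y \<Longrightarrow> lin_indep2 (J x) (J y)"
  unfolding lin_indep2_def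
proof (intro allI impI)
  fix \<alpha> \<beta> assume ind: "\<forall>\<alpha> \<beta>. \<alpha> *\<^sub>R x + \<beta> *\<^sub>R y = 0 \<longrightarrow> \<alpha> = 0 \<and> \<beta> = 0"
    and "\<alpha> *\<^sub>R J x + \<beta> *\<^sub>R J y = 0"
  then have "J (\<alpha> *\<^sub>R x) = J ((- \<beta>) *\<^sub>R y)" unfolding J_scaleR by (simp add: eq_neg_iff_add_eq_0)
  then have "\<alpha> *\<^sub>R x + \<beta> *\<^sub>R y = 0" unfolding J_eq_iff by simp
  then show "\<alpha> = 0 \<and> \<beta> = 0" using ind by blast
qed

end

section \<open>The duality map as a collineation, and its linearization on planes\<close>

locale planar_duality = uniform_banach X for X :: "'a::banach itself" +
  assumes J_add_in_span: "\<exists>\<alpha> \<beta>. duality_map ((x::'a) + y) = \<alpha> *\<^sub>R duality_map x + \<beta> *\<^sub>R duality_map y"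
begin

lemma J_combination: "\<exists>\<alpha> \<beta>. J (a *\<^sub>R x + b *\<^sub>R y) = \<alpha> *\<^sub>R J x + \<beta> *\<^sub>R J y"
  using J_add_in_span[of "a *\<^sub>R x" "b *\<^sub>R y"] by (metis J_scaleR scaleR_scaleR)

text \<open>Along the segment from \<open>x\<close> to \<open>y\<close> (or to \<open>- y\<close>) the direction of \<open>J\<close> turns
  continuously inside the plane spanned by \<open>J x\<close> and \<open>J y\<close>, so the intermediate value theorem
  applies to it.\<close>

lemma J_plane_onto:
  assumes ind: "lin_indep2 x y"
  shows "\<exists>p q. J (p *\<^sub>R x + q *\<^sub>R y) = \<alpha> *\<^sub>R J x + \<beta> *\<^sub>R J y"
proof -
  obtain u v where uv: "J x u = 1" "J y u = 0" "J x v = 0" "J y v = 1"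
    using functionals_dual_pair[of "J x" "J y"] J_lin_indep2[OF ind] unfolding lin_indep2_def by metis
  \<comment> \<open>\<open>h s\<close> is the determinant of the coefficients of
    \<open>J (z s)\<close> against \<alpha> and \<beta>, so a zero means that the two are parallel.
    The sign \<epsilon> ensures that \<open>h 0 = \<beta>\<close> and
    \<open>h 1 = - \<epsilon> * \<alpha>\<close> do not have the same strict sign.\<close>
  define \<epsilon> :: real where "\<epsilon> = (if \<alpha> * \<beta> \<ge> 0 then 1 else -1)"
  define z where "z s = (1 - s) *\<^sub>R x + (s * \<epsilon>) *\<^sub>R y" for s
  define h where "h s = J (z s) u * \<beta> - J (z s) v * \<alpha>" for s
  have "isCont z s" for s unfolding z_def by (intro continuous_intros)
  then have "isCont (\<lambda>s. J (z s) w) s" for s w unfolding isCont_def by (rule tendsto_J_fixed)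
  then have "continuous_on {0..1} h" unfolding h_def
    by (intro continuous_intros continuous_at_imp_continuous_on) auto
  moreover have h0: "h 0 = \<beta>" using uv by (simp add: h_def z_def)
  moreover have h1: "h 1 = - \<epsilon> * \<alpha>" using uv by (simp add: h_def z_def J_scaleR blinfun.scaleR_left)
  moreover have "h 0 \<le> 0 \<and> 0 \<le> h 1 \<or> h 1 \<le> 0 \<and> 0 \<le> h 0"
    unfolding h0 h1 by (auto simp: \<epsilon>_def zero_le_mult_iff)
  ultimately obtain s where s: "h s = 0"
    using IVT'[of h 0 0 1] IVT2'[of h 1 0 0] by force
  obtain A B where AB: "J (z s) = A *\<^sub>R J x + B *\<^sub>R J y"
    using J_combination unfolding z_def by blast
  have "J (z s) u = A" "J (z s) v = B" unfolding AB using uv by (simp_all add: blinfun.add_left blinfun.scaleR_left)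
  then have cross: "A * \<beta> = B * \<alpha>" using s by (simp add: h_def)
  have "z s \<noteq> 0"
  proof
    assume "z s = 0"
    then have "1 - s = 0 \<and> s * \<epsilon> = 0" using ind unfolding z_def lin_indep2_def by blast
    then show False by (auto simp: \<epsilon>_def split: if_splits)
  qed
  then have "A \<noteq> 0 \<or> B \<noteq> 0" using AB J_eq_0_iff[of "z s"] by auto
  then obtain k where "\<alpha> = k * A" "\<beta> = k * B"
  proof
    assume "A \<noteq> 0" then show ?thesis using cross by (intro that[of "\<alpha> / A"]) (auto simp: field_simps)
  next
    assume "B \<noteq> 0" then show ?thesis using cross by (intro that[of "\<beta> / B"]) (auto simp: field_simps)
  qed
  then have "J (k *\<^sub>R z s) = \<alpha> *\<^sub>R J x + \<beta> *\<^sub>R J y"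
    unfolding J_scaleR AB by (simp add: scaleR_add_right)
  moreover have "k *\<^sub>R z s = (k * (1 - s)) *\<^sub>R x + (k * (s * \<epsilon>)) *\<^sub>R y"
    by (simp add: z_def scaleR_add_right)
  ultimately show ?thesis by metis
qed

text \<open>If \<open>J z\<close> lay in the plane of \<open>J x\<close> and \<open>J y\<close>,
  then by \<open>J_plane_onto\<close> it would be the image of a combination of \<open>x\<close> and
  \<open>y\<close>, and injectivity would put \<open>z\<close> into their plane.\<close>

lemma J_lin_indep3:
  assumes ind: "lin_indep3 x y z"
  shows "lin_indep3 (J x) (J y) (J z)"
  unfolding lin_indep3_def
proof (intro allI impI)
  fix a b c assume eq: "a *\<^sub>R J x + b *\<^sub>R J y + c *\<^sub>R J z = 0"
  note ind2 = lin_indep3_imp_lin_indep2(1)[OF ind]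
  have "c = 0"
  proof (rule ccontr)
    assume c: "c \<noteq> 0"
    obtain p q where pq: "J (p *\<^sub>R x + q *\<^sub>R y) = (- a) *\<^sub>R J x + (- b) *\<^sub>R J y"
      using J_plane_onto[OF ind2] by blast
    also have "\<dots> = J (c *\<^sub>R z)" using eq by (simp add: J_scaleR add_eq_0_iff)
    finally have "p *\<^sub>R x + q *\<^sub>R y + (- c) *\<^sub>R z = 0" by (simp add: J_eq_iff)
    then show False using ind c unfolding lin_indep3_def by (metis neg_equal_0_iff_equal)
  qed
  then show "a = 0 \<and> b = 0 \<and> c = 0"
    using eq J_lin_indep2[OF ind2] unfolding lin_indep2_def by simp
qed

text \<open>\<open>lifts e u T\<close> singles out the multiple \<open>T\<close> of \<open>J u\<close> normalised so that the line of
  \<open>J (e + u)\<close> contains \<open>J e + T\<close>. As in the fundamental theorem of projective geometry,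
  \<open>u \<mapsto> T\<close> turns out to be additive.\<close>

definition lifts :: "'a \<Rightarrow> 'a \<Rightarrow> ('a \<Rightarrow>\<^sub>L real) \<Rightarrow> bool" where
  "lifts e u T \<longleftrightarrow> (\<exists>k. T = k *\<^sub>R J u) \<and> (\<exists>\<alpha>. \<alpha> \<noteq> 0 \<and> J (e + u) = \<alpha> *\<^sub>R (J e + T))"

lemma lifts_exists:
  assumes ind: "lin_indep2 e u"
  obtains k where "lifts e u (k *\<^sub>R J u)"
proof -
  obtain \<alpha> \<beta> where ab: "J (e + u) = \<alpha> *\<^sub>R J e + \<beta> *\<^sub>R J u" using J_add_in_span by blast
  have "\<alpha> \<noteq> 0"
  proof
    assume "\<alpha> = 0"
    then have "J (e + u) = J (\<beta> *\<^sub>R u)" using ab by (simp add: J_scaleR)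
    then have "1 *\<^sub>R e + (1 - \<beta>) *\<^sub>R u = 0" unfolding J_eq_iff by (simp add: algebra_simps)
    then show False using ind unfolding lin_indep2_def by (metis zero_neq_one)
  qed
  then have "J (e + u) = \<alpha> *\<^sub>R (J e + (\<beta> / \<alpha>) *\<^sub>R J u)" using ab by (simp add: scaleR_add_right)
  then show ?thesis using \<open>\<alpha> \<noteq> 0\<close> that[of "\<beta> / \<alpha>"] unfolding lifts_def by blast
qed

lemma lifts_nonzero:
  assumes ind: "lin_indep2 e u" and l: "lifts e u (k *\<^sub>R J u)"
  shows "k \<noteq> 0"
proof
  assume "k = 0"
  then obtain \<alpha> where "J (e + u) = J (\<alpha> *\<^sub>R e)" using l unfolding lifts_def by (auto simp: J_scaleR)
  then have "(1 - \<alpha>) *\<^sub>R e + 1 *\<^sub>R u = 0" unfolding J_eq_iff by (simp add: algebra_simps)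
  then show False using ind unfolding lin_indep2_def by (metis zero_neq_one)
qed

lemma lifts_unique:
  assumes ind: "lin_indep2 e u" and l: "lifts e u S" "lifts e u T"
  shows "S = T"
proof -
  obtain k a where S: "S = k *\<^sub>R J u" "a \<noteq> 0" "J (e + u) = a *\<^sub>R (J e + S)"
    using l(1) unfolding lifts_def by blast
  obtain m b where T: "T = m *\<^sub>R J u" "b \<noteq> 0" "J (e + u) = b *\<^sub>R (J e + T)"
    using l(2) unfolding lifts_def by blast
  have "a *\<^sub>R (J e + k *\<^sub>R J u) = b *\<^sub>R (J e + m *\<^sub>R J u)" using S T by simp
  then have "(a - b) *\<^sub>R J e + (a * k - b * m) *\<^sub>R J u = 0" by (simp add: algebra_simps)
  then have "a = b" "a * k = b * m" using J_lin_indep2[OF ind] unfolding lin_indep2_def by force+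
  then show ?thesis using S T by simp
qed

text \<open>Express \<open>J (e + f + g)\<close> in the basis \<open>J e\<close>, \<open>T\<close>,
  \<open>S\<close> in two ways: through \<open>e + f\<close> the coefficients of \<open>J e\<close>
  and \<open>T\<close> agree, through \<open>e + g\<close> those of \<open>J e\<close> and
  \<open>S\<close>. Hence all three agree.\<close>

lemma lifts_add:
  assumes ind: "lin_indep3 e f g" and T: "lifts e f T" and S: "lifts e g S"
  shows "lifts e (f + g) (T + S)"
proof -
  note J3 = J_lin_indep3[OF ind]
  note i = lin_indep3_imp_lin_indep2[OF ind]
  obtain k a where k: "T = k *\<^sub>R J f" and a: "a \<noteq> 0" "J (e + f) = a *\<^sub>R (J e + T)"
    using T unfolding lifts_def by blast
  obtain m b where m: "S = m *\<^sub>R J g" and b: "b \<noteq> 0" "J (e + g) = b *\<^sub>R (J e + S)"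
    using S unfolding lifts_def by blast
  have k0: "k \<noteq> 0" and m0: "m \<noteq> 0" using lifts_nonzero i T S k m by blast+
  have indTS: "x = x' \<and> y = y' \<and> z = z'"
    if "x *\<^sub>R J e + y *\<^sub>R T + z *\<^sub>R S = x' *\<^sub>R J e + y' *\<^sub>R T + z' *\<^sub>R S" for x y z x' y' z'
  proof -
    have "(x - x') *\<^sub>R J e + ((y - y') * k) *\<^sub>R J f + ((z - z') * m) *\<^sub>R J g = 0"
      using that unfolding k m by (simp add: algebra_simps)
    then have "x - x' = 0 \<and> (y - y') * k = 0 \<and> (z - z') * m = 0"
      using J3 unfolding lin_indep3_def by blast
    then show ?thesis using k0 m0 by simp
  qed
  have Jf: "J f = (1 / k) *\<^sub>R T" and Jg: "J g = (1 / m) *\<^sub>R S" using k0 m0 k m by auto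
  obtain c d where cd: "J (e + f + g) = c *\<^sub>R J (e + f) + d *\<^sub>R J g" using J_add_in_span by blast
  then have 1: "J (e + f + g) = (c * a) *\<^sub>R J e + (c * a) *\<^sub>R T + (d / m) *\<^sub>R S"
    unfolding a Jg by (simp add: algebra_simps)
  obtain c' d' where "J (e + g + f) = c' *\<^sub>R J (e + g) + d' *\<^sub>R J f" using J_add_in_span by blast
  then have "J (e + f + g) = (c' * b) *\<^sub>R J e + (d' / k) *\<^sub>R T + (c' * b) *\<^sub>R S"
    unfolding b Jf by (simp add: algebra_simps)
  then have "c * a = d / m" using indTS 1 by metis
  then have sum: "J (e + f + g) = (c * a) *\<^sub>R (J e + (T + S))"
    using 1 by (simp add: scaleR_add_right)
  have "e + f + g \<noteq> 0"
    using ind unfolding lin_indep3_def by (metis scaleR_one zero_neq_one)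
  then have ca: "c * a \<noteq> 0" using sum J_eq_0_iff[of "e + f + g"] by auto
  obtain p q where "J (f + g) = p *\<^sub>R J f + q *\<^sub>R J g" using J_add_in_span by blast
  then have 2: "J (f + g) = 0 *\<^sub>R J e + (p / k) *\<^sub>R T + (q / m) *\<^sub>R S" unfolding Jf Jg by simp
  \<comment> \<open>Subtracting \<open>e\<close> from \<open>e + f + g\<close> keeps the
    coefficients of \<open>T\<close> and \<open>S\<close> equal, so \<open>J (f + g)\<close> is a
    multiple of \<open>T + S\<close>.\<close>
  obtain p' q' where "J ((e + f + g) + (-1) *\<^sub>R e) = p' *\<^sub>R J (e + f + g) + q' *\<^sub>R J ((-1) *\<^sub>R e)"
    using J_add_in_span by blast
  then have "J (f + g) = (p' * (c * a) - q') *\<^sub>R J e + (p' * (c * a)) *\<^sub>R T + (p' * (c * a)) *\<^sub>R S"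
    unfolding sum J_scaleR by (simp add: algebra_simps)
  then have "p / k = q / m" using indTS 2 by metis
  then have eq: "J (f + g) = (p / k) *\<^sub>R (T + S)" using 2 by (simp add: scaleR_add_right)
  have "f + g \<noteq> 0"
    using ind unfolding lin_indep3_def by (metis scaleR_one zero_neq_one scaleR_zero_left add_0)
  then have "p / k \<noteq> 0" using eq J_eq_0_iff[of "f + g"] by auto
  then have "T + S = (1 / (p / k)) *\<^sub>R J (f + g)" unfolding eq by simp
  then show ?thesis using sum ca unfolding lifts_def by (metis add.assoc)
qed

text \<open>The scalars \<open>\<sigma> t\<close> describe the lifts along the line of
  \<open>f\<close>. \<open>lifts_add\<close> cannot be applied to two multiples of \<open>f\<close>,
  which are dependent; the third vector \<open>h\<close> serves to make the summands
  independent.\<close>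

lemma J_plane_projectively_linear:
  assumes ind: "lin_indep3 e f h"
  obtains w1 w2 where "\<And>x y. \<exists>c. J (x *\<^sub>R e + y *\<^sub>R f) = c *\<^sub>R (x *\<^sub>R w1 + y *\<^sub>R w2)"
proof -
  have ind_ef: "x *\<^sub>R e + y *\<^sub>R f + z *\<^sub>R h = 0 \<Longrightarrow> x = 0 \<and> y = 0 \<and> z = 0" for x y z
    using ind unfolding lin_indep3_def by blast
  have i2: "lin_indep2 e (t *\<^sub>R f)" if "t \<noteq> 0" for t
    unfolding lin_indep2_def using ind_ef[of _ "_ * t" 0] that by force
  have i2h: "lin_indep2 e (t *\<^sub>R f + h)" for t
    unfolding lin_indep2_def using ind_ef[of _ "_ * t" _]
    by (metis (no_types, opaque_lifting) add.assoc scaleR_add_right scaleR_scaleR)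
  have i3: "lin_indep3 e (s *\<^sub>R f) (t *\<^sub>R f + h)" if "s \<noteq> 0" for s t
    unfolding lin_indep3_def
  proof (intro allI impI)
    fix x y z assume "x *\<^sub>R e + y *\<^sub>R s *\<^sub>R f + z *\<^sub>R (t *\<^sub>R f + h) = 0"
    then have "x *\<^sub>R e + (y * s + z * t) *\<^sub>R f + z *\<^sub>R h = 0" by (simp add: algebra_simps)
    then have "x = 0 \<and> y * s + z * t = 0 \<and> z = 0" by (rule ind_ef)
    then show "x = 0 \<and> y = 0 \<and> z = 0" using that by auto
  qed
  have "\<exists>k. lifts e (t *\<^sub>R f) (k *\<^sub>R J f)" if "t \<noteq> 0" for t
    using lifts_exists[OF i2[OF that]] by (metis J_scaleR scaleR_scaleR)
  then obtain \<tau> where \<tau>: "\<And>t. t \<noteq> 0 \<Longrightarrow> lifts e (t *\<^sub>R f) (\<tau> t *\<^sub>R J f)" by metis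
  \<comment> \<open>The value at 0 is set by hand, since the lifts were chosen only for nonzero
    multiples of \<open>f\<close>; 0 is what additivity demands.\<close>
  define \<sigma> where "\<sigma> t = (if t = 0 then 0 else \<tau> t)" for t
  have \<sigma>: "lifts e (t *\<^sub>R f) (\<sigma> t *\<^sub>R J f)" if "t \<noteq> 0" for t using \<tau> that by (simp add: \<sigma>_def)
  have \<sigma>0: "\<sigma> 0 = 0" by (simp add: \<sigma>_def)
  obtain H where H: "lifts e h H" using lifts_exists[of e h] i2h[of 0] by auto
  have add_step: "lifts e ((s + t) *\<^sub>R f + h) (\<sigma> s *\<^sub>R J f + T)" if "lifts e (t *\<^sub>R f + h) T" for s t T
  proof (cases "s = 0")
    case True then show ?thesis using that by (simp add: \<sigma>0)
  next
    case False
    then show ?thesis using lifts_add[OF i3[OF False] \<sigma>[OF False] that] by (simp add: algebra_simps)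
  qed
  have f0: "J f \<noteq> 0" using ind_ef[of 0 1 0] J_eq_0_iff by auto
  have \<sigma>_add: "\<sigma> (s + t) = \<sigma> s + \<sigma> t" for s t
  proof -
    \<comment> \<open>The lift of \<open>(s + t) *\<^sub>R f + h\<close> is computed at once and in
      two stages; uniqueness of lifts equates the results.\<close>
    have h: "lifts e (r *\<^sub>R f + h) (\<sigma> r *\<^sub>R J f + H)" for r using add_step[of 0 H r] H by simp
    have "\<sigma> s *\<^sub>R J f + (\<sigma> t *\<^sub>R J f + H) = \<sigma> (s + t) *\<^sub>R J f + H"
      using lifts_unique[OF i2h add_step[OF h] h] .
    then have "(\<sigma> s + \<sigma> t - \<sigma> (s + t)) *\<^sub>R J f = 0" by (simp add: algebra_simps)
    then show ?thesis using f0 by simp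
  qed
  have J_line: "\<exists>\<alpha>. \<alpha> \<noteq> 0 \<and> J (e + t *\<^sub>R f) = \<alpha> *\<^sub>R (J e + \<sigma> t *\<^sub>R J f)" for t
  proof (cases "t = 0")
    case True then show ?thesis by (intro exI[of _ 1]) (simp add: \<sigma>0)
  next
    case False then show ?thesis using \<sigma>[OF False] unfolding lifts_def by blast
  qed
  obtain u v where uv: "J e u = 1" "J f u = 0" "J e v = 0" "J f v = 1"
    using functionals_dual_pair[of "J e" "J f"] J_lin_indep2[of e f] i2[of 1]
    unfolding lin_indep2_def by (metis scaleR_one zero_neq_one)
  \<comment> \<open>Evaluation at the dual vectors writes \<sigma> as a quotient, so it inherits
    continuity from \<open>J\<close>.\<close>
  have \<sigma>_eq: "\<sigma> t = J (e + t *\<^sub>R f) v / J (e + t *\<^sub>R f) u" and den: "J (e + t *\<^sub>R f) u \<noteq> 0" for t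
    using J_line[of t] uv by (auto simp: blinfun.add_left blinfun.scaleR_left)
  have "isCont (\<lambda>t. J (e + t *\<^sub>R f) w) t" for t w
    unfolding isCont_def by (intro tendsto_J_fixed tendsto_intros)
  then have "continuous_on UNIV (\<lambda>t. J (e + t *\<^sub>R f) v / J (e + t *\<^sub>R f) u)"
    using den by (intro continuous_intros continuous_at_imp_continuous_on) auto
  then have cont: "continuous_on UNIV \<sigma>" by (simp flip: \<sigma>_eq)
  have \<sigma>_lin: "\<sigma> t = t * \<sigma> 1" for t by (rule additive_continuous_imp_linear[OF \<sigma>_add cont])
  have \<sigma>1: "\<sigma> 1 \<noteq> 0" using lifts_nonzero[of e f "\<sigma> 1"] i2[of 1] \<sigma>[of 1] by simp
  show ?thesis
  proof (rule that[of "J e" "\<sigma> 1 *\<^sub>R J f"])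
    fix x y :: real
    show "\<exists>c. J (x *\<^sub>R e + y *\<^sub>R f) = c *\<^sub>R (x *\<^sub>R J e + y *\<^sub>R \<sigma> 1 *\<^sub>R J f)"
    proof (cases "x = 0")
      \<comment> \<open>The direction of \<open>f\<close> is the point at infinity of the line
        treated in \<open>J_line\<close>.\<close>
      case True
      then show ?thesis using \<sigma>1 by (intro exI[of _ "1 / \<sigma> 1"]) (simp add: J_scaleR)
    next
      case False
      obtain \<alpha> where "J (e + (y / x) *\<^sub>R f) = \<alpha> *\<^sub>R (J e + \<sigma> (y / x) *\<^sub>R J f)" using J_line by blast
      then have "J (x *\<^sub>R (e + (y / x) *\<^sub>R f)) = x *\<^sub>R \<alpha> *\<^sub>R (J e + (y / x * \<sigma> 1) *\<^sub>R J f)"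
        unfolding J_scaleR using \<sigma>_lin[of "y / x"] by simp
      then have "J (x *\<^sub>R e + y *\<^sub>R f) = \<alpha> *\<^sub>R (x *\<^sub>R J e + y *\<^sub>R \<sigma> 1 *\<^sub>R J f)"
        using False by (simp add: scaleR_add_right mult.commute)
      then show ?thesis by blast
    qed
  qed
qed

section \<open>Euclidean planes and symmetry of the duality pairing\<close>

text \<open>In coordinates where the symmetric part of \<open>v\<close> is the identity, the gradient \<open>J\<close> of \<open>F\<close>
  annihilates the velocity of the logarithmic spiral below, so \<open>F\<close> is constant on it. Comparing
  one full turn with the start gives \<open>a = 0\<close>, and then the spiral is a circle.\<close>

lemma J_euclidean_on_plane:
  assumes Jpar: "\<And>x y. \<exists>c. J (x *\<^sub>R u1 + y *\<^sub>R u2) = c *\<^sub>R (x *\<^sub>R v1 + y *\<^sub>R v2)"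
    and v: "blinfun_apply v1 u1 = 1" "blinfun_apply v2 u2 = 1"
      "blinfun_apply v1 u2 = a" "blinfun_apply v2 u1 = - a"
  shows "J (x *\<^sub>R u1 + y *\<^sub>R u2) (x' *\<^sub>R u1 + y' *\<^sub>R u2) = (norm u1)\<^sup>2 * (x * x' + y * y')"
proof -
  define p where "p t = (exp (- a * t) * cos t) *\<^sub>R u1 + (exp (- a * t) * sin t) *\<^sub>R u2" for t
  define p' where "p' t = (exp (- a * t) * (- a * cos t - sin t)) *\<^sub>R u1
      + (exp (- a * t) * (- a * sin t + cos t)) *\<^sub>R u2" for t
  have "(p has_vector_derivative p' t) (at t)" for t
    unfolding p_def p'_def
    by (auto intro!: derivative_eq_intros simp: has_real_derivative_iff_has_vector_derivative[symmetric] algebra_simps)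
  then have "((\<lambda>t. F (p t)) has_real_derivative J (p t) (p' t)) (at t)" for t
    by (rule F_path_has_derivative)
  moreover have "J (p t) (p' t) = 0" for t
  proof -
    obtain c where c: "J (p t) = c *\<^sub>R ((exp (- a * t) * cos t) *\<^sub>R v1 + (exp (- a * t) * sin t) *\<^sub>R v2)"
      using Jpar unfolding p_def by blast
    show ?thesis unfolding c p'_def
      unfolding blinfun.add_left blinfun.scaleR_left blinfun.add_right blinfun.scaleR_right v
      by (simp add: algebra_simps)
  qed
  ultimately have "\<forall>t. ((\<lambda>t. F (p t)) has_real_derivative 0) (at t)" by simp
  then have const: "F (p t) = F (p 0)" for t by (rule DERIV_isconst_all)
  have p0: "p 0 = u1" by (simp add: p_def)
  have "u1 \<noteq> 0" using v(1) by auto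
  then have F0: "F u1 \<noteq> 0" by (simp add: F_def)
  have "p (2 * pi) = exp (- a * (2 * pi)) *\<^sub>R u1" by (simp add: p_def)
  then have "F (p (2 * pi)) = (exp (- a * (2 * pi)))\<^sup>2 * F u1" by (simp only: F_scaleR)
  then have "(exp (- a * (2 * pi)))\<^sup>2 = 1" using const[of "2 * pi"] p0 F0 by simp
  moreover have "exp (- a * (2 * pi)) \<noteq> - 1" using exp_gt_zero[of "- a * (2 * pi)"] by linarith
  ultimately have a0: "a = 0" by (simp add: power2_eq_1_iff)
  have circle: "F (cos t *\<^sub>R u1 + sin t *\<^sub>R u2) = F u1" for t
    using const[of t] p0 by (simp add: p_def a0)
  have F_eq: "F (x *\<^sub>R u1 + y *\<^sub>R u2) = (x\<^sup>2 + y\<^sup>2) * F u1"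
  proof -
    obtain r t where rt: "x = r * cos t" "y = r * sin t" using polar_Ex by blast
    have "x *\<^sub>R u1 + y *\<^sub>R u2 = r *\<^sub>R (cos t *\<^sub>R u1 + sin t *\<^sub>R u2)"
      by (simp add: rt scaleR_add_right)
    then have "F (x *\<^sub>R u1 + y *\<^sub>R u2) = r\<^sup>2 * F u1" by (simp only: F_scaleR circle)
    moreover have "x\<^sup>2 + y\<^sup>2 = r\<^sup>2"
      unfolding rt power_mult_distrib by (simp flip: distrib_left)
    ultimately show ?thesis by simp
  qed
  obtain c where c: "J (x *\<^sub>R u1 + y *\<^sub>R u2) = c *\<^sub>R (x *\<^sub>R v1 + y *\<^sub>R v2)" using Jpar by blast
  then have Jz: "J (x *\<^sub>R u1 + y *\<^sub>R u2) (x' *\<^sub>R u1 + y' *\<^sub>R u2) = c * (x * x' + y * y')" for x' y'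
    by (simp add: blinfun.add_left blinfun.scaleR_left blinfun.add_right blinfun.scaleR_right v a0 algebra_simps)
  \<comment> \<open>So far \<open>c\<close> depends on the point. Pairing \<open>J\<close> of the
    point with the point itself identifies \<open>c\<close> as \<open>(norm u1)\<^sup>2\<close>,
    unless the point is 0.\<close>
  have "c * (x * x + y * y) = 2 * F (x *\<^sub>R u1 + y *\<^sub>R u2)"
    using Jz[of x y] J_self[of "x *\<^sub>R u1 + y *\<^sub>R u2"] by (simp add: F_def)
  then have "(c - (norm u1)\<^sup>2) * (x * x + y * y) = 0"
    unfolding F_eq by (simp add: F_def power2_eq_square algebra_simps)
  then have "c = (norm u1)\<^sup>2 \<or> x = 0 \<and> y = 0" by (simp add: sum_squares_eq_zero_iff)
  then show ?thesis using Jz by auto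
qed

text \<open>A change of basis turns the symmetric part of the bilinear form given by
  \<open>w1\<close>, \<open>w2\<close> into the identity, as \<open>J_euclidean_on_plane\<close>
  requires. This is possible because the quadratic form has no nontrivial zero: \<open>J z z\<close>
  is a multiple of it and vanishes only at 0.\<close>

lemma J_symmetric_of_plane_coordinates:
  assumes ind: "lin_indep2 e f"
    and Jpar: "\<And>x y. \<exists>c. J (x *\<^sub>R e + y *\<^sub>R f) = c *\<^sub>R (x *\<^sub>R w1 + y *\<^sub>R w2)"
    and pos: "blinfun_apply w1 e > 0"
  shows "J e f = J f e"
proof -
  \<comment> \<open>Completing the square: the quadratic form of \<open>w1\<close>,
    \<open>w2\<close> at \<open>x *\<^sub>R e + y *\<^sub>R f\<close> equals
    \<open>b * (x + m * y)\<^sup>2 + r * y\<^sup>2\<close>.\<close>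
  define b m r where "b = w1 e" and "m = (w1 f + w2 e) / (2 * b)" and "r = w2 f - b * m\<^sup>2"
  have b: "b > 0" using pos by (simp add: b_def)
  have m: "w1 f + w2 e = 2 * b * m" using b by (simp add: m_def)
  have nz: "b * (x + m * y)\<^sup>2 + r * y\<^sup>2 \<noteq> 0" if "x \<noteq> 0 \<or> y \<noteq> 0" for x y
  proof
    assume zero: "b * (x + m * y)\<^sup>2 + r * y\<^sup>2 = 0"
    obtain c where c: "J (x *\<^sub>R e + y *\<^sub>R f) = c *\<^sub>R (x *\<^sub>R w1 + y *\<^sub>R w2)" using Jpar by blast
    have "(norm (x *\<^sub>R e + y *\<^sub>R f))\<^sup>2 = c * (x * x * w1 e + x * y * (w1 f + w2 e) + y * y * w2 f)"
      unfolding J_self[symmetric] c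
      by (simp add: blinfun.add_left blinfun.scaleR_left blinfun.add_right blinfun.scaleR_right algebra_simps)
    also have "\<dots> = c * (b * (x + m * y)\<^sup>2 + r * y\<^sup>2)"
      unfolding m r_def by (simp add: b_def power2_eq_square algebra_simps)
    finally have "x *\<^sub>R e + y *\<^sub>R f = 0" using zero by simp
    then show False using ind that unfolding lin_indep2_def by blast
  qed
  have r: "r > 0"
  proof (rule ccontr)
    assume "\<not> r > 0"
    then have "- r / b \<ge> 0" using b by (simp add: divide_nonpos_pos)
    then have "(sqrt (- r / b) - m + m * 1)\<^sup>2 = - r / b" by simp
    then have "b * (sqrt (- r / b) - m + m * 1)\<^sup>2 + r * 1\<^sup>2 = 0" using b by simp
    then show False using nz[of "sqrt (- r / b) - m" 1] by simp
  qed
  define \<beta> \<rho> where "\<beta> = sqrt b" and "\<rho> = sqrt r"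
  have \<beta>: "\<beta> > 0" "\<beta> * \<beta> = b" and \<rho>: "\<rho> > 0" "\<rho> * \<rho> = r" using b r by (auto simp: \<beta>_def \<rho>_def)
  \<comment> \<open>The same change of coordinates is applied to \<open>e\<close>, \<open>f\<close>
    and to \<open>w1\<close>, \<open>w2\<close>, so proportionality persists; only an antisymmetric
    off-diagonal entry remains.\<close>
  define u1 u2 where "u1 = (1 / \<beta>) *\<^sub>R e" and "u2 = (1 / \<rho>) *\<^sub>R (f - m *\<^sub>R e)"
  define v1 v2 where "v1 = (1 / \<beta>) *\<^sub>R w1" and "v2 = (1 / \<rho>) *\<^sub>R (w2 - m *\<^sub>R w1)"
  note bl = blinfun.add_left blinfun.scaleR_left blinfun.add_right blinfun.scaleR_right
    blinfun.diff_left blinfun.diff_right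
  have "\<exists>c. J (x *\<^sub>R u1 + y *\<^sub>R u2) = c *\<^sub>R (x *\<^sub>R v1 + y *\<^sub>R v2)" for x y
  proof -
    have "x *\<^sub>R u1 + y *\<^sub>R u2 = (x / \<beta> - m * y / \<rho>) *\<^sub>R e + (y / \<rho>) *\<^sub>R f"
      by (simp add: u1_def u2_def algebra_simps)
    moreover have "x *\<^sub>R v1 + y *\<^sub>R v2 = (x / \<beta> - m * y / \<rho>) *\<^sub>R w1 + (y / \<rho>) *\<^sub>R w2"
      by (simp add: v1_def v2_def algebra_simps)
    ultimately show ?thesis using Jpar by metis
  qed
  moreover have "v1 u1 = 1" using \<beta> b by (simp add: v1_def u1_def bl flip: b_def)
  moreover have "v2 u2 = 1"
  proof -
    have "v2 u2 = (w2 f - m * (w1 f + w2 e) + m * m * w1 e) / (\<rho> * \<rho>)"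
      by (simp add: v2_def u2_def bl diff_divide_distrib add_divide_distrib algebra_simps)
    also have "w2 f - m * (w1 f + w2 e) + m * m * w1 e = r"
      unfolding m by (simp add: r_def b_def power2_eq_square algebra_simps)
    finally show ?thesis using r \<rho> by simp
  qed
  moreover have "v2 u1 = - v1 u2"
  proof -
    have "v2 u1 + v1 u2 = (w1 f + w2 e - 2 * b * m) / (\<beta> * \<rho>)"
      by (simp add: v1_def v2_def u1_def u2_def bl b_def diff_divide_distrib add_divide_distrib algebra_simps)
    then show ?thesis using m by simp
  qed
  ultimately have eucl: "J (x *\<^sub>R u1 + y *\<^sub>R u2) (x' *\<^sub>R u1 + y' *\<^sub>R u2) = (norm u1)\<^sup>2 * (x * x' + y * y')"
    for x y x' y'
    using J_euclidean_on_plane[of u1 u2 v1 v2 "v1 u2"] by blast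
  have "e = \<beta> *\<^sub>R u1 + 0 *\<^sub>R u2" using \<beta> by (simp add: u1_def)
  moreover have "f = (m * \<beta>) *\<^sub>R u1 + \<rho> *\<^sub>R u2" using \<beta> \<rho> by (simp add: u1_def u2_def)
  ultimately show ?thesis using eucl[of \<beta> 0 "m * \<beta>" \<rho>] eucl[of "m * \<beta>" \<rho> \<beta> 0] by simp
qed

lemma J_symmetric:
  assumes ind: "lin_indep3 e f h"
  shows "J e f = J f e"
proof -
  obtain w1 w2 where Jpar: "\<And>x y. \<exists>c. J (x *\<^sub>R e + y *\<^sub>R f) = c *\<^sub>R (x *\<^sub>R w1 + y *\<^sub>R w2)"
    using J_plane_projectively_linear[OF ind] by blast
  note ind2 = lin_indep3_imp_lin_indep2(1)[OF ind]
  obtain c where c: "J e = c *\<^sub>R w1" using Jpar[of 1 0] by auto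
  have "e \<noteq> 0" using ind2 unfolding lin_indep2_def by (metis scaleR_one scaleR_zero_left add.right_neutral zero_neq_one)
  then have "w1 e \<noteq> 0" using J_self[of e] unfolding c by (auto simp: blinfun.scaleR_left)
  \<comment> \<open>The pair \<open>w1\<close>, \<open>w2\<close> matters only up to a common
    factor, so its sign can be reversed.\<close>
  then consider "w1 e > 0" | "(- w1) e > 0" by (fastforce simp: blinfun.minus_left)
  then show ?thesis
  proof cases
    case 1 then show ?thesis using J_symmetric_of_plane_coordinates[OF ind2 Jpar] by blast
  next
    case 2
    have "\<exists>c. J (x *\<^sub>R e + y *\<^sub>R f) = c *\<^sub>R (x *\<^sub>R (- w1) + y *\<^sub>R (- w2))" for x y
    proof -
      obtain c where "J (x *\<^sub>R e + y *\<^sub>R f) = c *\<^sub>R (x *\<^sub>R w1 + y *\<^sub>R w2)" using Jpar by blast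
      then show ?thesis by (intro exI[of _ "- c"]) (simp add: algebra_simps)
    qed
    then show ?thesis using J_symmetric_of_plane_coordinates[OF ind2 _ 2] by blast
  qed
qed

text \<open>Independent pairs extend to independent triples because \<open>S\<close> does not fit
  into a plane, so \<open>J_symmetric\<close> applies; dependent pairs are settled by homogeneity of
  \<open>J\<close>.\<close>

lemma inner_product_space_if_dim_ge_3:
  assumes "\<exists>S :: 'a set. independent S \<and> card S = 3"
  shows "inner_product_space X"
proof -
  obtain S :: "'a set" where S: "independent S" "card S = 3" using assms by blast
  have sym: "J x y = J y x" for x y
  proof (cases "lin_indep2 x y")
    case True
    have "\<not> S \<subseteq> span {x, y}"
    proof
      assume "S \<subseteq> span {x, y}"
      then have "card S \<le> card {x, y}" using independent_span_bound[of "{x, y}" S] S by simp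
      also have "card {x, y} \<le> 2" by (simp add: card_insert_if)
      finally show False using S by simp
    qed
    then obtain h where h: "h \<notin> span {x, y}" by blast
    have "lin_indep3 x y h" unfolding lin_indep3_def
    proof (intro allI impI)
      fix a b c assume eq: "a *\<^sub>R x + b *\<^sub>R y + c *\<^sub>R h = 0"
      have "c = 0"
      proof (rule ccontr)
        assume "c \<noteq> 0"
        have "c *\<^sub>R h = - (a *\<^sub>R x + b *\<^sub>R y)" using eq by (simp add: add_eq_0_iff)
        then have "h = (1 / c) *\<^sub>R (- (a *\<^sub>R x + b *\<^sub>R y))" using \<open>c \<noteq> 0\<close>
          by (metis divide_self_if scaleR_one scaleR_scaleR times_divide_eq_left mult_1)
        moreover have "\<dots> \<in> span {x, y}"
          by (intro span_scale span_neg span_add span_base) auto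
        ultimately show False using h by simp
      qed
      then show "a = 0 \<and> b = 0 \<and> c = 0" using eq True unfolding lin_indep2_def by simp
    qed
    then show ?thesis by (rule J_symmetric)
  next
    case False
    then obtain k where "x = k *\<^sub>R y \<or> y = k *\<^sub>R x" by (rule lin_dep2_cases)
    then show ?thesis by (auto simp: J_scaleR blinfun.scaleR_left blinfun.scaleR_right)
  qed
  show ?thesis unfolding inner_product_space_def
  proof (intro exI[of _ "\<lambda>x y. J y x"] conjI allI)
    fix x y
    show "J y x = J x y" by (rule sym)
    show "linear (\<lambda>x. J y x)" by (rule bounded_linear.linear[OF blinfun.bounded_linear_right])
    show "norm x = sqrt (J x x)" by (simp add: J_self)
  qed
qed

end

section \<open>The duality map of an inner product space; planes and halfspaces\<close>

text \<open>\<open>J x\<close> is in fact \<open>B x\<close>: since \<open>F\<close> is quadratic,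
  the subgradient inequality reads \<open>J x v \<le> B x v + s * F v\<close> for every positive
  \<open>s\<close>, and \<open>- v\<close> gives the reverse bound.\<close>

lemma (in uniform_banach) J_add_if_inner_product_space:
  assumes "inner_product_space X"
  shows "J (x + y) = J x + J y"
proof -
  obtain B :: "'a \<Rightarrow> 'a \<Rightarrow> real" where sym: "\<And>x y. B x y = B y x"
    and lin: "\<And>y. linear (\<lambda>x. B x y)" and nrm: "\<And>x. norm x = sqrt (B x x)"
    using assms unfolding inner_product_space_def by blast
  have add: "B (x + y) z = B x z + B y z" and scale: "B (c *\<^sub>R x) z = c * B x z" for x y z c
    using linear_add[OF lin] linear_scale[OF lin] by auto
  have add': "B z (x + y) = B z x + B z y" and scale': "B z (c *\<^sub>R x) = c * B z x" for x y z c
    using add scale sym by metis+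
  \<comment> \<open>Real \<open>sqrt\<close> is odd, so \<open>B x x\<close> is nonnegative because
    the norm is.\<close>
  have sq: "F x = B x x / 2" for x
    unfolding F_def using nrm[of x] by (metis norm_ge_zero real_sqrt_ge_0_iff real_sqrt_pow2)
  have le: "J x v \<le> B x v" for x v
  proof (rule field_le_epsilon)
    fix e :: real assume e: "e > 0"
    \<comment> \<open>The summand 1 keeps the denominator positive when
      \<open>F v = 0\<close>.\<close>
    define s where "s = e / (F v + 1)"
    have Fv: "F v \<ge> 0" by (simp add: F_def)
    then have s: "s > 0" "s * F v \<le> e" using e by (auto simp: s_def field_simps)
    have "s * J x v \<le> F (x + s *\<^sub>R v) - F x"
      using J_subgradient[of x "x + s *\<^sub>R v"] by (simp add: blinfun.scaleR_right)
    also have "\<dots> = s * (B x v + s * F v)"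
      unfolding sq by (simp add: add scale add' scale' sym[of v x] field_simps)
    finally have "J x v \<le> B x v + s * F v" using s(1) by simp
    then show "J x v \<le> B x v + e" using s by simp
  qed
  have "J x v = B x v" for x v
    using le[of x v] le[of x "(-1) *\<^sub>R v"] unfolding scale' blinfun.scaleR_right by simp
  then show ?thesis by (intro blinfun_eqI) (simp add: add blinfun.add_left)
qed

lemma independent_if_lin_indep2:
  assumes "lin_indep2 x y"
  shows "independent {x, y}" "card {x, y} = 2"
proof -
  have "x \<noteq> k *\<^sub>R y" for k
  proof
    assume "x = k *\<^sub>R y"
    then have "1 *\<^sub>R x + (- k) *\<^sub>R y = 0" by simp
    then show False using assms unfolding lin_indep2_def by (metis zero_neq_one)
  qed
  moreover have "y \<noteq> 0"
    using assms unfolding lin_indep2_def by (metis scaleR_zero_left scaleR_zero_right add_0 zero_neq_one)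
  moreover have "x \<noteq> y" using \<open>\<And>k. x \<noteq> k *\<^sub>R y\<close> by (metis scaleR_one)
  ultimately show "independent {x, y}" "card {x, y} = 2"
    by (auto simp: independent_insert span_singleton)
qed

lemma dim_injective_linear_image:
  assumes "linear f" "inj f" "subspace D"
  shows "dim (f ` D) = dim D"
proof -
  obtain B where B: "B \<subseteq> D" "independent B" "D \<subseteq> span B" "card B = dim D"
    using basis_exists by blast
  have "D = span B" using B assms(3) by (metis span_minimal subset_antisym)
  then have "span (f ` B) = span (f ` D)"
    by (simp add: linear_span_image[OF assms(1)] span_span)
  moreover have "independent (f ` B)"
    using linear_independent_injective_image[OF assms(1) B(2)] assms(2) inj_on_subset by blast
  ultimately have "dim (f ` D) = card (f ` B)" using dim_eq_card by blast
  also have "\<dots> = dim D" using assms(2) B(4) by (simp add: card_image inj_on_subset)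
  finally show ?thesis .
qed

lemma closed_halfspace_imp_closed_convex_cone:
  fixes H :: "'a::real_normed_vector set"
  assumes "closed_halfspace H"
  shows "closed H" "convex_cone H"
proof -
  obtain a :: "'a \<Rightarrow>\<^sub>L real" where "H = {x. a x \<ge> 0} \<or> H = {x. a x \<le> 0}"
    using assms unfolding closed_halfspace_def by blast
  moreover have "closed {x. a x \<ge> 0}" "closed {x. a x \<le> 0}"
    by (intro closed_Collect_le continuous_intros)+
  moreover have "convex_cone {x. a x \<ge> 0}" "convex_cone {x. a x \<le> 0}"
    by (auto simp: convex_cone_iff blinfun.add_right blinfun.scaleR_right mult_nonneg_nonpos)
  ultimately show "closed H" "convex_cone H" by auto
qed

section \<open>The individual implications between the assertions\<close>

context uniform_banach
begin

lemma closed_hyperplane_J: "x \<noteq> 0 \<Longrightarrow> closed_hyperplane {z. J x z = 0}"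
  unfolding closed_hyperplane_def
  by (intro exI[of _ "(1 / norm x) *\<^sub>R J x"]) (simp add: norm_J blinfun.scaleR_left)

lemma closed_halfspace_J: "x \<noteq> 0 \<Longrightarrow> closed_halfspace {z. J x z \<le> 0}"
  unfolding closed_halfspace_def
  by (intro exI[of _ "(1 / norm x) *\<^sub>R J x"]) (simp add: norm_J blinfun.scaleR_left divide_le_0_iff)

text \<open>For a dependent pair the sum is a multiple of one of the two vectors, so homogeneity of
  \<open>J\<close> suffices.\<close>

lemma planar_dualityI:
  assumes "\<And>x y. lin_indep2 x y \<Longrightarrow> x \<noteq> 0 \<Longrightarrow> y \<noteq> 0 \<Longrightarrow> \<exists>\<alpha> \<beta>. J (x + y) = \<alpha> *\<^sub>R J x + \<beta> *\<^sub>R J y"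
  shows "planar_duality X"
proof unfold_locales
  fix x y :: 'a
  show "\<exists>\<alpha> \<beta>. J (x + y) = \<alpha> *\<^sub>R J x + \<beta> *\<^sub>R J y"
  proof (cases "lin_indep2 x y")
    case True
    then have "x \<noteq> 0" "y \<noteq> 0"
      unfolding lin_indep2_def
      by (metis scaleR_zero_left scaleR_zero_right add_0 add.right_neutral zero_neq_one)+
    then show ?thesis using assms True by blast
  next
    case False
    then obtain k where "x = k *\<^sub>R y \<or> y = k *\<^sub>R x" by (rule lin_dep2_cases)
    then show ?thesis
    proof
      assume "x = k *\<^sub>R y"
      then have "x + y = (k + 1) *\<^sub>R y" by (simp add: algebra_simps)
      then show ?thesis by (intro exI[of _ 0] exI[of _ "k + 1"]) (simp only: J_scaleR, simp)
    next
      assume "y = k *\<^sub>R x"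
      then have "x + y = (k + 1) *\<^sub>R x" by (simp add: algebra_simps)
      then show ?thesis by (intro exI[of _ "k + 1"] exI[of _ 0]) (simp only: J_scaleR, simp)
    qed
  qed
qed

lemma in_span_J_if_vanishing:
  assumes ind: "lin_indep2 x y"
    and van: "\<And>z. J x z = 0 \<Longrightarrow> J y z = 0 \<Longrightarrow> blinfun_apply f z = 0"
  shows "\<exists>\<alpha> \<beta>. f = \<alpha> *\<^sub>R J x + \<beta> *\<^sub>R J y"
proof -
  obtain u v where "J x u = 1" "J y u = 0" "J x v = 0" "J y v = 1"
    using functionals_dual_pair[of "J x" "J y"] J_lin_indep2[OF ind] unfolding lin_indep2_def by metis
  then show ?thesis using functional_vanishing_on_two_kernels van by blast
qed

text \<open>On the intersection of the kernels of \<open>J x\<close> and \<open>J y\<close> both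
  \<open>x\<close> and \<open>y\<close> project to 0. By linearity so does \<open>x + y\<close>,
  hence \<open>J (x + y)\<close> vanishes on this intersection.\<close>

lemma planar_duality_if_hyperplane_proj_linear:
  assumes lin: "\<And>H1 H2 :: 'a set. closed_hyperplane H1 \<Longrightarrow> closed_hyperplane H2 \<Longrightarrow>
    linear (metric_proj (H1 \<inter> H2))"
  shows "planar_duality X"
proof (rule planar_dualityI)
  fix x y :: 'a assume ind: "lin_indep2 x y" and nz: "x \<noteq> 0" "y \<noteq> 0"
  define M where "M = {z. J x z = 0} \<inter> {z. J y z = 0}"
  have M: "subspace M" "closed M"
    unfolding M_def by (intro subspace_inter subspace_kernel closed_Int closed_kernel)+
  note proj = metric_proj_subspace_eq_iff[OF M, of _ 0] subspace_0[OF M(1)]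
  have "linear (metric_proj M)" unfolding M_def using nz by (intro lin closed_hyperplane_J)
  moreover have "metric_proj M x = 0" "metric_proj M y = 0" using proj by (auto simp: M_def)
  ultimately have "metric_proj M (x + y) = 0" by (simp add: linear_add)
  then have "J (x + y) z = 0" if "J x z = 0" "J y z = 0" for z
    using proj that by (auto simp: M_def)
  then show "\<exists>\<alpha> \<beta>. J (x + y) = \<alpha> *\<^sub>R J x + \<beta> *\<^sub>R J y" by (rule in_span_J_if_vanishing[OF ind])
qed

text \<open>Both \<open>x\<close> and \<open>y\<close> lie in the polar of \<open>K\<close>;
  convexity and homogeneity give \<open>J (x + y) z \<le> 0\<close> on \<open>K\<close>. The joint
  kernel of \<open>J x\<close> and \<open>J y\<close> lies in \<open>K\<close> and is symmetric, so
  \<open>J (x + y)\<close> vanishes there.\<close>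

lemma planar_duality_if_halfspace_polar_convex:
  assumes conv: "\<And>H1 H2 :: 'a set. closed_halfspace H1 \<Longrightarrow> closed_halfspace H2 \<Longrightarrow>
    convex (polar (H1 \<inter> H2))"
  shows "planar_duality X"
proof (rule planar_dualityI)
  fix x y :: 'a assume ind: "lin_indep2 x y" and nz: "x \<noteq> 0" "y \<noteq> 0"
  define K where "K = {z. J x z \<le> 0} \<inter> {z. J y z \<le> 0}"
  note half = closed_halfspace_J[OF nz(1)] closed_halfspace_J[OF nz(2)]
  have K: "convex_cone K" "closed K"
    unfolding K_def using half[THEN closed_halfspace_imp_closed_convex_cone(1)]
      half[THEN closed_halfspace_imp_closed_convex_cone(2)]
    by (auto simp: convex_cone_iff)
  have "convex (polar K)" unfolding K_def by (intro conv half)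
  moreover have "x \<in> polar K" "y \<in> polar K" unfolding polar_eq[OF K] by (auto simp: K_def)
  ultimately have "(1/2) *\<^sub>R x + (1/2) *\<^sub>R y \<in> polar K" by (intro convexD) auto
  then have "(1/2) *\<^sub>R (x + y) \<in> polar K" by (simp add: scaleR_add_right)
  then have le: "J (x + y) z \<le> 0" if "z \<in> K" for z
    using that unfolding polar_eq[OF K] by (auto simp: J_scaleR blinfun.scaleR_left)
  have "J (x + y) z = 0" if "J x z = 0" "J y z = 0" for z
    using le[of z] le[of "- z"] that by (auto simp: K_def blinfun.minus_right)
  then show "\<exists>\<alpha> \<beta>. J (x + y) = \<alpha> *\<^sub>R J x + \<beta> *\<^sub>R J y" by (rule in_span_J_if_vanishing[OF ind])
qed

text \<open>The preimage under \<open>J\<close> of the plane of \<open>J x\<close> and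
  \<open>J y\<close> contains \<open>x\<close> and \<open>y\<close>, hence also
  \<open>x + y\<close>.\<close>

lemma planar_duality_if_inv_J_maps_planes:
  assumes planes: "\<And>D. subspace D \<Longrightarrow> dim D = 2 \<Longrightarrow> subspace (inv J ` D)"
  shows "planar_duality X"
proof (rule planar_dualityI)
  fix x y :: 'a assume ind: "lin_indep2 x y"
  define D where "D = span {J x, J y}"
  have "dim D = 2"
    unfolding D_def using independent_if_lin_indep2[OF J_lin_indep2[OF ind]]
    by (metis dim_span_eq_card_independent)
  then have "subspace (inv J ` D)" using planes by (simp add: D_def)
  moreover have "x \<in> inv J ` D" "y \<in> inv J ` D"
    using inv_f_f[OF inj_J] by (metis D_def image_eqI insertCI span_base)+
  ultimately have "x + y \<in> inv J ` D" by (rule subspace_add)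
  then have "J (x + y) \<in> D" using surj_f_inv_f[OF surj_J] by auto
  then obtain \<alpha> where "J (x + y) - \<alpha> *\<^sub>R J x \<in> span {J y}" unfolding D_def span_insert by blast
  then obtain \<beta> where "J (x + y) - \<alpha> *\<^sub>R J x = \<beta> *\<^sub>R J y" unfolding span_singleton by blast
  then show "\<exists>\<alpha> \<beta>. J (x + y) = \<alpha> *\<^sub>R J x + \<beta> *\<^sub>R J y" by (metis add.commute diff_add_cancel)
qed

text \<open>Projections are characterized by \<open>J\<close> of the residual vanishing on
  \<open>M\<close>; once \<open>J\<close> is additive, sums and multiples of residuals satisfy the
  same condition.\<close>

lemma linear_metric_proj_if_inner_product_space:
  fixes M :: "'a set"
  assumes ip: "inner_product_space X" and M: "subspace M" "closed M"
  shows "linear (metric_proj M)"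
proof -
  note proj = metric_proj_subspace_eq_iff[OF M]
  have P: "metric_proj M x \<in> M" "\<And>d. d \<in> M \<Longrightarrow> J (x - metric_proj M x) d = 0" for x
    using proj by blast+
  show ?thesis
  proof (rule linearI)
    fix x y
    have "x + y - (metric_proj M x + metric_proj M y) = (x - metric_proj M x) + (y - metric_proj M y)"
      by simp
    then have "J (x + y - (metric_proj M x + metric_proj M y))
        = J (x - metric_proj M x) + J (y - metric_proj M y)"
      by (simp only: J_add_if_inner_product_space[OF ip])
    then show "metric_proj M (x + y) = metric_proj M x + metric_proj M y"
      using P M(1) by (simp add: proj subspace_add blinfun.add_left)
  next
    fix c x
    have "J (c *\<^sub>R x - c *\<^sub>R metric_proj M x) = c *\<^sub>R J (x - metric_proj M x)"
      by (simp add: J_scaleR flip: scaleR_diff_right)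
    then show "metric_proj M (c *\<^sub>R x) = c *\<^sub>R metric_proj M x"
      using P M(1) by (simp add: proj subspace_scale blinfun.scaleR_left)
  qed
qed

lemma inv_J_maps_planes_if_inner_product_space:
  assumes ip: "inner_product_space X" and D: "subspace D" "dim D = 2"
  shows "subspace (inv J ` D) \<and> dim (inv J ` D) = 2"
proof -
  have J_inv: "J (inv J f) = f" for f using surj_f_inv_f[OF surj_J] .
  have "linear (inv J)"
  proof (rule linearI)
    fix f g c
    show "inv J (f + g) = inv J f + inv J g"
      using J_eq_iff by (metis J_inv J_add_if_inner_product_space[OF ip])
    show "inv J (c *\<^sub>R f) = c *\<^sub>R inv J f" using J_eq_iff by (metis J_inv J_scaleR)
  qed
  moreover have "inj (inv J)" using surj_J by (rule surj_imp_inj_inv)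
  ultimately show ?thesis
    using D by (simp add: dim_injective_linear_image linear_subspace_image)
qed

lemma convex_polar_if_inner_product_space:
  fixes K :: "'a set"
  assumes ip: "inner_product_space X" and K: "convex_cone K" "closed K"
  shows "convex (polar K)"
  unfolding polar_eq[OF K]
proof (rule convexI)
  fix x y and u v :: real
  assume xy: "x \<in> {x. \<forall>d\<in>K. J x d \<le> 0}" "y \<in> {x. \<forall>d\<in>K. J x d \<le> 0}"
    and uv: "0 \<le> u" "0 \<le> v" "u + v = 1"
  show "u *\<^sub>R x + v *\<^sub>R y \<in> {x. \<forall>d\<in>K. J x d \<le> 0}"
    using xy uv by (auto simp: J_add_if_inner_product_space[OF ip] J_scaleR blinfun.add_left
        blinfun.scaleR_left intro!: add_nonpos_nonpos mult_nonneg_nonpos)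
qed

end

section \<open>The equivalence of all assertions\<close>

theorem theorem1:
  fixes X :: "'a::banach itself"
  assumes "uniformly_convex X" and "uniformly_smooth X" and "reflexive_space X"
    and "\<exists>S :: 'a set. independent S \<and> card S = 3"
  shows "((\<forall>M :: 'a set. subspace M \<and> closed M \<longrightarrow> linear (metric_proj M))
          \<longleftrightarrow> (\<forall>H1 H2 :: 'a set. closed_hyperplane H1 \<and> closed_hyperplane H2
                 \<longrightarrow> linear (metric_proj (H1 \<inter> H2))))
       \<and> ((\<forall>H1 H2 :: 'a set. closed_hyperplane H1 \<and> closed_hyperplane H2
                 \<longrightarrow> linear (metric_proj (H1 \<inter> H2)))
          \<longleftrightarrow> (\<forall>D :: ('a \<Rightarrow>\<^sub>L real) set. subspace D \<and> dim D = 2 \<longrightarrow>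
                 subspace (inv (duality_map :: 'a \<Rightarrow> _) ` D)
                 \<and> dim (inv (duality_map :: 'a \<Rightarrow> _) ` D) = 2))
       \<and> ((\<forall>D :: ('a \<Rightarrow>\<^sub>L real) set. subspace D \<and> dim D = 2 \<longrightarrow>
                 subspace (inv (duality_map :: 'a \<Rightarrow> _) ` D)
                 \<and> dim (inv (duality_map :: 'a \<Rightarrow> _) ` D) = 2)
          \<longleftrightarrow> (\<forall>H1 H2 :: 'a set. closed_halfspace H1 \<and> closed_halfspace H2
                 \<longrightarrow> convex (polar (H1 \<inter> H2))))
       \<and> ((\<forall>H1 H2 :: 'a set. closed_halfspace H1 \<and> closed_halfspace H2
                 \<longrightarrow> convex (polar (H1 \<inter> H2)))
          \<longleftrightarrow> (\<forall>K :: 'a set. convex_cone K \<and> closed K \<longrightarrow> convex (polar K)))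
       \<and> ((\<forall>K :: 'a set. convex_cone K \<and> closed K \<longrightarrow> convex (polar K))
          \<longleftrightarrow> inner_product_space X)"
proof -
  interpret uniform_banach X using assms(1,2) by unfold_locales
  have ip: "inner_product_space X" if "planar_duality X"
    using planar_duality.inner_product_space_if_dim_ge_3[OF that assms(4)] .
  define i where "i \<longleftrightarrow> (\<forall>M :: 'a set. subspace M \<and> closed M \<longrightarrow> linear (metric_proj M))"
  define ii where "ii \<longleftrightarrow> (\<forall>H1 H2 :: 'a set. closed_hyperplane H1 \<and> closed_hyperplane H2
      \<longrightarrow> linear (metric_proj (H1 \<inter> H2)))"
  define iii where "iii \<longleftrightarrow> (\<forall>D :: ('a \<Rightarrow>\<^sub>L real) set. subspace D \<and> dim D = 2 \<longrightarrow>
      subspace (inv (duality_map :: 'a \<Rightarrow> _) ` D) \<and> dim (inv (duality_map :: 'a \<Rightarrow> _) ` D) = 2)"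
  define iv where "iv \<longleftrightarrow> (\<forall>H1 H2 :: 'a set. closed_halfspace H1 \<and> closed_halfspace H2
      \<longrightarrow> convex (polar (H1 \<inter> H2)))"
  define v where "v \<longleftrightarrow> (\<forall>K :: 'a set. convex_cone K \<and> closed K \<longrightarrow> convex (polar K))"
  \<comment> \<open>The implications run in cycles through the inner product property: via
    \<open>i\<close> and \<open>ii\<close>, via \<open>iii\<close>, and via \<open>v\<close> and
    \<open>iv\<close>.\<close>
  have "i" if "inner_product_space X"
    unfolding i_def using linear_metric_proj_if_inner_product_space[OF that] by blast
  moreover have "ii" if "i"
    unfolding ii_def
  proof (intro allI impI)
    fix H1 H2 :: "'a set" assume H: "closed_hyperplane H1 \<and> closed_hyperplane H2"
    then have "subspace (H1 \<inter> H2) \<and> closed (H1 \<inter> H2)"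
      unfolding closed_hyperplane_def
      by (auto intro!: subspace_inter subspace_kernel closed_Int closed_kernel)
    then show "linear (metric_proj (H1 \<inter> H2))" using that i_def by blast
  qed
  moreover have "inner_product_space X" if "ii"
    using that planar_duality_if_hyperplane_proj_linear ip unfolding ii_def by blast
  moreover have "inner_product_space X" if "iii"
    using that planar_duality_if_inv_J_maps_planes ip unfolding iii_def by blast
  moreover have "inner_product_space X" if "iv"
    using that planar_duality_if_halfspace_polar_convex ip unfolding iv_def by blast
  moreover have "iii" if "inner_product_space X"
    unfolding iii_def using inv_J_maps_planes_if_inner_product_space[OF that] by blast
  moreover have "v" if "inner_product_space X"
    unfolding v_def using convex_polar_if_inner_product_space[OF that] by blast
  moreover have "iv" if "v"
    unfolding iv_def
  proof (intro allI impI)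
    fix H1 H2 :: "'a set" assume H: "closed_halfspace H1 \<and> closed_halfspace H2"
    then have "closed (H1 \<inter> H2) \<and> convex_cone (H1 \<inter> H2)"
      using closed_halfspace_imp_closed_convex_cone[of H1] closed_halfspace_imp_closed_convex_cone[of H2]
      by (auto simp: convex_cone_iff)
    then show "convex (polar (H1 \<inter> H2))" using that v_def by blast
  qed
  ultimately show ?thesis
    unfolding i_def[symmetric] ii_def[symmetric] iii_def[symmetric] iv_def[symmetric] v_def[symmetric]
    by blast
qed

end
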